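(* Let $n\ge 2$, $k\ge1$, and let $A=(a_{ij})\in\mathbb{M}(n)$ be nonnegative. Let $x_{ij}=\min\{a_{ij},a_{ji}\}$ for all $i$ and $j$, and let $X=(x_{ij})\in\mathbb{M}(n)$. Then, for any positive unital linear map $\Phi:\mathbb{M}(n)\to\mathbb{M}(k)$, $$\rho(A)\,I_k\ \ge\ \frac{b_{11}+b_{22}}{2}\,I_k+\left(\Phi(X^2)-\Phi(X)^2\right)^{1/2},$$ where $b_{11}$ and $b_{22}$ respectively denote the first and the second smallest diagonal entries of $A$.
   Context: $\mathbb{M}(n)$ is the algebra of all $n\times n$ complex matrices and $I_k$ is the $k\times k$ identity matrix. A matrix $A=(a_{ij})$ is nonnegative if $a_{ij}\ge0$ for all $i,j$ (entrywise); $A$ is not assumed symmetric. $\rho(A)=\max\{|\lambda|:\lambda\in\sigma(A)\}$ is the spectral radius, where $\sigma(A)$ is the spectrum of $A$. A linear map $\Phi:\mathbb{M}(n)\to\mathbb{M}(k)$ is positive if $\Phi(M)$ is positive semidefinite whenever $M$ is positive semidefinite, and unital if $\Phi(I_n)=I_k$. For Hermitian $k\times k$ matrices, $P\ge Q$ means that $P-Q$ is positive semidefinite. Since $X$ is real symmetric, $\Phi(X^2)-\Phi(X)^2$ is positive semidefinite (Kadison's inequality), and $(\cdot)^{1/2}$ denotes the positive semidefinite square root. The smallest diagonal entries are counted with multiplicity. *)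

theory Defs
  imports
    "Jordan_Normal_Form.Spectral_Radius"
    "Jordan_Normal_Form.Schur_Decomposition"
    "Jordan_Normal_Form.Missing_VectorSpace"
begin

definition hermitian_mat :: "nat \<Rightarrow> complex mat \<Rightarrow> bool" where
  "hermitian_mat n M \<longleftrightarrow> M \<in> carrier_mat n n \<and> mat_adjoint M = M"

text \<open>On the type \<^typ>\<open>complex\<close> the library order (theory \<open>Complex_Order\<close>) makes \<open>0 \<le> z\<close> say
  that \<open>z\<close> is a nonnegative real number.  The expression \<open>(M *\<^sub>v v) \<bullet>c v\<close> is the form \<open>v\<^sup>* M v\<close>.\<close>

definition psd_mat :: "nat \<Rightarrow> complex mat \<Rightarrow> bool" where
  "psd_mat n M \<longleftrightarrow> hermitian_mat n M \<and> (\<forall>v \<in> carrier_vec n. 0 \<le> (M *\<^sub>v v) \<bullet>c v)"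

definition loewner_ge :: "nat \<Rightarrow> complex mat \<Rightarrow> complex mat \<Rightarrow> bool" where
  "loewner_ge n P Q \<longleftrightarrow> hermitian_mat n P \<and> hermitian_mat n Q \<and> psd_mat n (P - Q)"

text \<open>The description is meant for positive semidefinite \<open>P\<close>, which have exactly one
  positive semidefinite square root.\<close>

definition psd_sqrt :: "nat \<Rightarrow> complex mat \<Rightarrow> complex mat" where
  "psd_sqrt n P = (THE B. psd_mat n B \<and> B * B = P)"

definition linear_map_mat :: "nat \<Rightarrow> nat \<Rightarrow> (complex mat \<Rightarrow> complex mat) \<Rightarrow> bool" where
  "linear_map_mat n k \<Phi> \<longleftrightarrow>
     linear_map class_ring (module_mat TYPE(complex) n n) (module_mat TYPE(complex) k k) \<Phi>"

lemma linear_map_mat_iff: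
  "linear_map_mat n k \<Phi> \<longleftrightarrow>
     (\<forall>M \<in> carrier_mat n n. \<Phi> M \<in> carrier_mat k k) \<and>
     (\<forall>M \<in> carrier_mat n n. \<forall>N \<in> carrier_mat n n. \<Phi> (M + N) = \<Phi> M + \<Phi> N) \<and>
     (\<forall>c. \<forall>M \<in> carrier_mat n n. \<Phi> (c \<cdot>\<^sub>m M) = c \<cdot>\<^sub>m \<Phi> M)"
  using matrix_vs[where 'a = complex, of n n] matrix_vs[where 'a = complex, of k k]
  unfolding linear_map_mat_def linear_map_def mod_hom_def mod_hom_axioms_def
    LinearCombinations.module_hom_def vectorspace_def
  by (auto simp: module_mat_simps Pi_def)

definition positive_map :: "nat \<Rightarrow> nat \<Rightarrow> (complex mat \<Rightarrow> complex mat) \<Rightarrow> bool" where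
  "positive_map n k \<Phi> \<longleftrightarrow> (\<forall>M. psd_mat n M \<longrightarrow> psd_mat k (\<Phi> M))"

definition unital_map :: "nat \<Rightarrow> nat \<Rightarrow> (complex mat \<Rightarrow> complex mat) \<Rightarrow> bool" where
  "unital_map n k \<Phi> \<longleftrightarrow> \<Phi> (1\<^sub>m n) = 1\<^sub>m k"

text \<open>For nonnegative entries \<open>min\<close> below, taken in the partial order of \<^typ>\<open>complex\<close>,
  is the ordinary minimum of two real numbers.\<close>

definition min_sym_mat :: "complex mat \<Rightarrow> complex mat" where
  "min_sym_mat A = mat (dim_row A) (dim_col A) (\<lambda>(i, j). min (A $$ (i, j)) (A $$ (j, i)))"

text \<open>The diagonal entries of a matrix with real diagonal, in increasing order and repeated
  according to multiplicity.\<close>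

definition sorted_diag :: "complex mat \<Rightarrow> real list" where
  "sorted_diag A = sort (map Re (diag_mat A))"

end

theory Submission
  imports Defs
begin

text \<open>
  The matrix \<open>X\<close> is real symmetric. Write \<open>X = \<Sum>\<^sub>l d\<^sub>l u\<^sub>l u\<^sub>l\<^sup>*\<close> with an orthonormal basis
  (\<open>hermitian_spectral\<close>, \<open>spectral_decomposition\<close>), let \<open>m\<close> be the smallest of the \<open>d\<^sub>l\<close>, and put
  \<open>\<rho> = \<rho>(A)\<close>. Three facts together give the inequality.

  First, \<open>A\<close> dominates \<open>X\<close> entrywise, so \<open>d\<^sub>l \<le> \<rho>\<close> for all \<open>l\<close>
  (\<open>eigenvalue_le_spectral_radius_dominating\<close>). Thus the spectrum of \<open>X\<close> lies in \<open>[m, \<rho>]\<close>.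

  Second, the matrices \<open>\<Phi>(u\<^sub>l u\<^sub>l\<^sup>*)\<close> are positive semidefinite and add up to the identity, which makes
  \<open>\<Phi>(X\<^sup>2) - \<Phi>(X)\<^sup>2\<close> an operator variance of the points \<open>d\<^sub>l\<close>. It is positive semidefinite and
  bounded by \<open>((\<rho> - m) / 2)\<^sup>2\<close> (\<open>psd_resolution_variance\<close>), so that its square root is at most
  \<open>(\<rho> - m) / 2\<close> (\<open>psd_le_of_square_le\<close>).

  Third, \<open>b\<^sub>1\<^sub>1 + b\<^sub>2\<^sub>2 \<le> \<rho> + m\<close>. This is where nonnegativity of the entries of \<open>X\<close> enters a second time:
  splitting a real eigenvector for \<open>m\<close> into its positive and negative part exhibits two different diagonal
  entries of \<open>X\<close> whose sum is at most \<open>\<rho> + m\<close> (\<open>two_diagonal_entries_le\<close>), and the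
  diagonals of \<open>X\<close> and \<open>A\<close> agree.

  Consequently \<open>(b\<^sub>1\<^sub>1 + b\<^sub>2\<^sub>2) / 2 + (\<rho> - m) / 2 \<le> (\<rho> + m) / 2 + (\<rho> - m) / 2 = \<rho>\<close>.
\<close>

section \<open>The complex inner product and Hermitian matrices\<close>

lemma cscalar_prod_sum: "w \<in> carrier_vec n \<Longrightarrow> v \<bullet>c w = (\<Sum>i<n. v $ i * cnj (w $ i))" for v w :: "complex vec"
  by (auto simp: scalar_prod_def lessThan_atLeast0 intro!: sum.cong)

lemma mult_mat_vec_sum:
  "A \<in> carrier_mat m n \<Longrightarrow> v \<in> carrier_vec n \<Longrightarrow> i < m \<Longrightarrow> (A *\<^sub>v v) $ i = (\<Sum>j<n. A $$ (i, j) * v $ j)"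
  by (auto simp: scalar_prod_def lessThan_atLeast0 intro!: sum.cong)

lemma mult_mat_sum:
  "A \<in> carrier_mat m n \<Longrightarrow> B \<in> carrier_mat n k \<Longrightarrow> i < m \<Longrightarrow> j < k \<Longrightarrow>
    (A * B) $$ (i, j) = (\<Sum>l<n. A $$ (i, l) * B $$ (l, j))"
  by (auto simp: scalar_prod_def lessThan_atLeast0 intro!: sum.cong)

lemma cscalar_prod_commute:
  "v \<in> carrier_vec n \<Longrightarrow> w \<in> carrier_vec n \<Longrightarrow> w \<bullet>c v = cnj (v \<bullet>c w)" for v w :: "complex vec"
  by (simp add: cscalar_prod_sum mult.commute)

lemma cscalar_prod_self:
  "v \<in> carrier_vec n \<Longrightarrow> v \<bullet>c v = complex_of_real (\<Sum>i<n. (cmod (v $ i))\<^sup>2)" for v :: "complex vec"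
  by (simp add: cscalar_prod_sum complex_norm_square[symmetric])

lemma cscalar_prod_self_Re:
  fixes v :: "complex vec"
  assumes "v \<in> carrier_vec n"
  shows "v \<bullet>c v = complex_of_real (Re (v \<bullet>c v))" "Re (v \<bullet>c v) \<ge> 0"
  using assms by (simp_all add: cscalar_prod_self sum_nonneg)

lemma cscalar_prod_smult:
  fixes v w :: "complex vec"
  assumes "v \<in> carrier_vec n" "w \<in> carrier_vec n"
  shows "(c \<cdot>\<^sub>v v) \<bullet>c w = c * (v \<bullet>c w)" "v \<bullet>c (c \<cdot>\<^sub>v w) = cnj c * (v \<bullet>c w)"
  using assms by (auto simp: cscalar_prod_sum[of _ n] sum_distrib_left mult_ac intro!: sum.cong)

lemma cscalar_prod_minus:
  fixes v w x :: "complex vec"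
  assumes "v \<in> carrier_vec n" "w \<in> carrier_vec n" "x \<in> carrier_vec n"
  shows "(v - w) \<bullet>c x = v \<bullet>c x - w \<bullet>c x" "x \<bullet>c (v - w) = x \<bullet>c v - x \<bullet>c w"
  using assms by (auto simp: cscalar_prod_sum[of _ n] sum_subtractf[symmetric] algebra_simps intro!: sum.cong)

lemma mat_adjoint_index:
  "A \<in> carrier_mat m n \<Longrightarrow> i < n \<Longrightarrow> j < m \<Longrightarrow> mat_adjoint A $$ (i, j) = cnj (A $$ (j, i))"
  by (auto simp add: mat_adjoint_def mat_of_rows_index)

lemma hermitian_mat_iff:
  "hermitian_mat n M \<longleftrightarrow> M \<in> carrier_mat n n \<and> (\<forall>i<n. \<forall>j<n. M $$ (i, j) = cnj (M $$ (j, i)))"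
proof (cases "M \<in> carrier_mat n n")
  case True
  then have "mat_adjoint M = M \<longleftrightarrow> (\<forall>i<n. \<forall>j<n. mat_adjoint M $$ (i, j) = M $$ (i, j))"
    unfolding mat_eq_iff by (auto simp: mat_adjoint_def)
  also have "\<dots> \<longleftrightarrow> (\<forall>i<n. \<forall>j<n. M $$ (i, j) = cnj (M $$ (j, i)))"
    using True by (simp add: mat_adjoint_index eq_commute)
  finally show ?thesis using True unfolding hermitian_mat_def by blast
qed (simp add: hermitian_mat_def)

lemma hermitian_mat_carrier: "hermitian_mat n M \<Longrightarrow> M \<in> carrier_mat n n"
  by (simp add: hermitian_mat_def)

lemma hermitian_mat_cnj:
  assumes "hermitian_mat n M" "i < n" "j < n"
  shows "cnj (M $$ (i, j)) = M $$ (j, i)"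
  using assms unfolding hermitian_mat_iff by metis

lemma hermitian_mat_minus:
  assumes "hermitian_mat n M" "hermitian_mat n N"
  shows "hermitian_mat n (M - N)"
  unfolding hermitian_mat_iff
  using hermitian_mat_carrier[OF assms(1)] hermitian_mat_carrier[OF assms(2)]
  by (auto simp: hermitian_mat_cnj[OF assms(1)] hermitian_mat_cnj[OF assms(2)])

lemma hermitian_mat_square:
  assumes M: "hermitian_mat n M"
  shows "hermitian_mat n (M * M)"
  unfolding hermitian_mat_iff
proof (intro conjI allI impI)
  note Mc = hermitian_mat_carrier[OF M]
  show "M * M \<in> carrier_mat n n" using Mc by auto
  fix i j assume ij: "i < n" "j < n"
  show "(M * M) $$ (i, j) = cnj ((M * M) $$ (j, i))"
    unfolding mult_mat_sum[OF Mc Mc ij] mult_mat_sum[OF Mc Mc ij(2,1)] cnj_sum complex_cnj_mult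
    using ij by (intro sum.cong refl) (simp add: hermitian_mat_cnj[OF M] mult.commute)
qed

lemma hermitian_cscalar_prod:
  assumes "hermitian_mat n M" "v \<in> carrier_vec n" "w \<in> carrier_vec n"
  shows "(M *\<^sub>v v) \<bullet>c w = v \<bullet>c (M *\<^sub>v w)"
proof -
  note M = hermitian_mat_carrier[OF assms(1)]
  have "(M *\<^sub>v v) \<bullet>c w = (\<Sum>i<n. \<Sum>j<n. M $$ (i, j) * v $ j * cnj (w $ i))"
    using M assms by (simp add: cscalar_prod_sum mult_mat_vec_sum[OF M] sum_distrib_right del: index_mult_mat_vec)
  also have "\<dots> = (\<Sum>j<n. \<Sum>i<n. v $ j * (cnj (M $$ (j, i)) * cnj (w $ i)))"
    by (subst sum.swap) (auto intro!: sum.cong simp: hermitian_mat_cnj[OF assms(1)] mult_ac)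
  also have "\<dots> = v \<bullet>c (M *\<^sub>v w)"
    using M assms by (simp add: cscalar_prod_sum[of _ n] mult_mat_vec_sum[OF M] sum_distrib_left del: index_mult_mat_vec)
  finally show ?thesis .
qed

section \<open>Orthonormal bases and the spectral theorem\<close>

definition orthonormal_basis :: "nat \<Rightarrow> (nat \<Rightarrow> complex vec) \<Rightarrow> bool" where
  "orthonormal_basis n u \<longleftrightarrow> (\<forall>l<n. u l \<in> carrier_vec n) \<and>
     (\<forall>l<n. \<forall>m<n. u l \<bullet>c u m = (if l = m then 1 else 0))"

lemma orthonormal_basisD:
  assumes "orthonormal_basis n u" "l < n"
  shows "u l \<in> carrier_vec n" "u l \<bullet>c u l = 1" "u l \<noteq> 0\<^sub>v n"
    "m < n \<Longrightarrow> u l \<bullet>c u m = (if l = m then 1 else 0)"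
proof -
  show "u l \<in> carrier_vec n" and uu: "u l \<bullet>c u l = 1" and "m < n \<Longrightarrow> u l \<bullet>c u m = (if l = m then 1 else 0)"
    using assms by (auto simp: orthonormal_basis_def)
  show "u l \<noteq> 0\<^sub>v n"
  proof
    assume "u l = 0\<^sub>v n"
    with uu show False by simp
  qed
qed

text \<open>The matrix with columns \<open>u l\<close> has its adjoint as a left inverse, hence also as a right inverse;
  reading the second product entrywise gives \<open>\<Sum>\<^sub>l u\<^sub>l u\<^sub>l\<^sup>* = I\<close>.\<close>

lemma orthonormal_basis_resolution:
  assumes u: "orthonormal_basis n u" and i: "i < n" and j: "j < n"
  shows "(\<Sum>l<n. u l $ i * cnj (u l $ j)) = (if i = j then 1 else 0)"
proof -
  define U where "U = mat n n (\<lambda>(i, l). u l $ i)"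
  define V where "V = mat n n (\<lambda>(l, i). cnj (u l $ i))"
  have UV: "U \<in> carrier_mat n n" "V \<in> carrier_mat n n" by (auto simp: U_def V_def)
  have "V * U = 1\<^sub>m n"
  proof (rule eq_matI)
    fix a b assume "a < dim_row (1\<^sub>m n :: complex mat)" "b < dim_col (1\<^sub>m n :: complex mat)"
    then have a: "a < n" and b: "b < n" by auto
    have "(V * U) $$ (a, b) = (\<Sum>l<n. u b $ l * cnj (u a $ l))"
      unfolding mult_mat_sum[OF UV(2,1) a b] using a b by (simp add: U_def V_def mult.commute)
    also have "\<dots> = u b \<bullet>c u a" using u a by (simp add: orthonormal_basis_def cscalar_prod_sum[of _ n])
    finally show "(V * U) $$ (a, b) = 1\<^sub>m n $$ (a, b)" using u a b by (auto simp: orthonormal_basis_def)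
  qed (use UV in auto)
  then have "U * V = 1\<^sub>m n" using mat_mult_left_right_inverse[OF UV(2,1)] by simp
  then have "(U * V) $$ (i, j) = (if i = j then 1 else 0)" using i j by simp
  then show ?thesis using i j unfolding mult_mat_sum[OF UV i j] by (simp add: U_def V_def)
qed

lemma orthonormal_basis_expand:
  assumes u: "orthonormal_basis n u" and v: "v \<in> carrier_vec n" and i: "i < n"
  shows "v $ i = (\<Sum>l<n. (v \<bullet>c u l) * u l $ i)"
proof -
  have "(\<Sum>l<n. (v \<bullet>c u l) * u l $ i) = (\<Sum>l<n. \<Sum>j<n. v $ j * (u l $ i * cnj (u l $ j)))"
    using u by (simp add: orthonormal_basis_def cscalar_prod_sum[of _ n] sum_distrib_left mult_ac)
  also have "\<dots> = (\<Sum>j<n. v $ j * (\<Sum>l<n. u l $ i * cnj (u l $ j)))"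
    by (subst sum.swap) (simp add: sum_distrib_left)
  also have "\<dots> = (\<Sum>j<n. v $ j * (if i = j then 1 else 0))"
    using i by (intro sum.cong refl) (simp add: orthonormal_basis_resolution[OF u])
  also have "\<dots> = v $ i" using i by (simp add: if_distrib cong: if_cong)
  finally show ?thesis by simp
qed

lemma orthonormal_basis_eqI:
  assumes u: "orthonormal_basis n u" and v: "v \<in> carrier_vec n" "w \<in> carrier_vec n"
    and eq: "\<And>l. l < n \<Longrightarrow> v \<bullet>c u l = w \<bullet>c u l"
  shows "v = w"
proof (rule eq_vecI)
  fix i assume "i < dim_vec w"
  then have i: "i < n" using v by auto
  show "v $ i = w $ i"
    unfolding orthonormal_basis_expand[OF u v(1) i] orthonormal_basis_expand[OF u v(2) i]
    by (simp add: eq)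
qed (use v in auto)

text \<open>Gram-Schmidt keeps the first vector of its input and yields orthogonal nonzero vectors; only
  the normalisation has to be added.\<close>

lemma extend_to_orthonormal_basis:
  assumes v: "v \<in> carrier_vec n" and v0: "v \<noteq> 0\<^sub>v n"
  obtains w c where "orthonormal_basis n w" "w 0 = c \<cdot>\<^sub>v v"
proof -
  interpret cof_vec_space n "TYPE(complex)" .
  define b where "b = basis_completion v"
  note b = basis_completion[OF v v0, folded b_def]
  define ws where "ws = gram_schmidt n b"
  from gram_schmidt_result[OF b(2,4,5) refl, folded ws_def] b(6)
  have ws: "set ws \<subseteq> carrier_vec n" "corthogonal ws" "length ws = n" by auto
  have n: "n \<noteq> 0" using v v0 by auto
  with b(6,7) obtain vs where "b = v # vs" by (cases b) auto
  then have "hd ws = v" using gram_schmidt_hd[OF v, of vs] by (simp add: ws_def)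
  then have ws0: "ws ! 0 = v" using ws(3) n by (metis hd_conv_nth length_0_conv)
  define s where "s = (\<lambda>l. 1 / sqrt (Re (ws ! l \<bullet>c ws ! l)))"
  define w where "w = (\<lambda>l. complex_of_real (s l) \<cdot>\<^sub>v (ws ! l))"
  have c: "ws ! l \<in> carrier_vec n" if "l < n" for l using ws that by auto
  have "w l \<bullet>c w m = (if l = m then 1 else 0)" if l: "l < n" and m: "m < n" for l m
  proof -
    have "w l \<bullet>c w m = of_real (s l) * (of_real (s m) * (ws ! l \<bullet>c ws ! m))"
      using c[OF l] c[OF m] by (simp add: w_def cscalar_prod_smult[of _ n])
    moreover have "ws ! l \<bullet>c ws ! m = 0" if "l \<noteq> m" using corthogonalD[OF ws(2), of l m] l m ws(3) that by simp
    moreover have "of_real (s l) * (of_real (s l) * (ws ! l \<bullet>c ws ! l)) = 1"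
    proof -
      define r where "r = Re (ws ! l \<bullet>c ws ! l)"
      have e: "ws ! l \<bullet>c ws ! l = of_real r" and "r \<ge> 0"
        unfolding r_def using cscalar_prod_self_Re[OF c[OF l]] by auto
      moreover have "ws ! l \<bullet>c ws ! l \<noteq> 0" using corthogonalD[OF ws(2), of l l] l ws(3) by simp
      ultimately have "r > 0" by auto
      then have "s l * (s l * r) = 1" by (simp add: s_def r_def[symmetric] field_simps)
      then show ?thesis unfolding e by (metis of_real_mult of_real_1)
    qed
    ultimately show ?thesis by auto
  qed
  then have "orthonormal_basis n w" using c by (auto simp: orthonormal_basis_def w_def)
  then show ?thesis using that[of w "complex_of_real (s 0)"] by (simp add: w_def ws0)
qed

lemma hermitian_eigenvalue_real:
  assumes M: "hermitian_mat n M" and v: "v \<in> carrier_vec n" "v \<noteq> 0\<^sub>v n" "M *\<^sub>v v = e \<cdot>\<^sub>v v"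
  shows "e = complex_of_real (Re e)"
proof -
  have "e * (v \<bullet>c v) = cnj e * (v \<bullet>c v)"
    using hermitian_cscalar_prod[OF M v(1) v(1)] v by (simp add: cscalar_prod_smult[of _ n])
  moreover have "v \<bullet>c v \<noteq> 0" using v by simp
  ultimately have "cnj e = e" by simp
  then show ?thesis by (simp add: complex_eq_iff)
qed

text \<open>Induction on the size. Complete an eigenvector \<open>v\<close> to an orthonormal basis \<open>w\<close> with
  \<open>w 0\<close> parallel to \<open>v\<close>. A Hermitian matrix maps the orthogonal complement of \<open>v\<close> into itself, and
  in the coordinates \<open>w (Suc i)\<close> it acts there by a Hermitian matrix of smaller size, whose
  eigenvectors are carried back isometrically.\<close>

theorem hermitian_spectral:
  "hermitian_mat n M \<Longrightarrow> \<exists>u d. orthonormal_basis n u \<and> (\<forall>l<n. M *\<^sub>v u l = complex_of_real (d l) \<cdot>\<^sub>v u l)"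
proof (induction n arbitrary: M)
  case 0
  then show ?case by (auto simp: orthonormal_basis_def)
next
  case (Suc n)
  let ?N = "Suc n"
  note M = Suc.prems
  have Mc: "M \<in> carrier_mat ?N ?N" using M by (rule hermitian_mat_carrier)
  obtain e where "e \<in> spectrum M" using spectrum_non_empty[OF Mc] by auto
  then obtain v where v: "v \<in> carrier_vec ?N" "v \<noteq> 0\<^sub>v ?N" "M *\<^sub>v v = e \<cdot>\<^sub>v v"
    using Mc unfolding spectrum_def eigenvalue_def eigenvector_def by auto
  obtain w c where w: "orthonormal_basis ?N w" and w0: "w 0 = c \<cdot>\<^sub>v v"
    using extend_to_orthonormal_basis[OF v(1,2)] by blast
  have wc: "w l \<in> carrier_vec ?N" if "l < ?N" for l
    using orthonormal_basisD(1)[OF w that] .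
  have ww: "w l \<bullet>c w m = (if l = m then 1 else 0)" if "l < ?N" "m < ?N" for l m
    using orthonormal_basisD(4)[OF w that] .
  have Mw0: "M *\<^sub>v w 0 = complex_of_real (Re e) \<cdot>\<^sub>v w 0"
    using v hermitian_eigenvalue_real[OF M v, symmetric] Mc
    by (simp add: w0 mult_mat_vec[OF Mc] smult_smult_assoc mult.commute)
  \<comment> \<open>the compression of \<open>M\<close> to the complement of the eigenvector, and the isometry onto that complement\<close>
  define C where "C = mat n n (\<lambda>(i, j). (M *\<^sub>v w (Suc j)) \<bullet>c w (Suc i))"
  have "hermitian_mat n C"
    unfolding hermitian_mat_iff
  proof (intro conjI allI impI)
    fix i j assume i: "i < n" and j: "j < n"
    then have c: "w (Suc i) \<in> carrier_vec ?N" "w (Suc j) \<in> carrier_vec ?N" using wc by auto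
    have "C $$ (i, j) = w (Suc j) \<bullet>c (M *\<^sub>v w (Suc i))"
      using i j hermitian_cscalar_prod[OF M c(2,1)] by (simp add: C_def)
    also have "\<dots> = cnj ((M *\<^sub>v w (Suc i)) \<bullet>c w (Suc j))"
      using c Mc by (intro cscalar_prod_commute) auto
    finally show "C $$ (i, j) = cnj (C $$ (j, i))" using i j by (simp add: C_def)
  qed (simp add: C_def)
  from Suc.IH[OF this] obtain u' d' where u': "orthonormal_basis n u'"
    and Cu: "\<And>l. l < n \<Longrightarrow> C *\<^sub>v u' l = complex_of_real (d' l) \<cdot>\<^sub>v u' l" by blast
  have u'c: "u' l \<in> carrier_vec n" if "l < n" for l
    using orthonormal_basisD(1)[OF u' that] .
  define embed where "embed = (\<lambda>z. vec ?N (\<lambda>i. \<Sum>j<n. z $ j * w (Suc j) $ i))"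
  have ec: "embed z \<in> carrier_vec ?N" for z by (simp add: embed_def)
  have embed_prod: "embed z \<bullet>c x = (\<Sum>j<n. z $ j * (w (Suc j) \<bullet>c x))" if x: "x \<in> carrier_vec ?N" for z x
  proof -
    have "embed z \<bullet>c x = (\<Sum>i<?N. \<Sum>j<n. z $ j * (w (Suc j) $ i * cnj (x $ i)))"
      unfolding cscalar_prod_sum[OF x] embed_def by (intro sum.cong refl) (simp add: sum_distrib_left mult_ac)
    also have "\<dots> = (\<Sum>j<n. z $ j * (w (Suc j) \<bullet>c x))"
      unfolding cscalar_prod_sum[OF x] by (subst sum.swap) (simp add: sum_distrib_left del: sum.lessThan_Suc)
    finally show ?thesis .
  qed
  have e0: "embed z \<bullet>c w 0 = 0" for z using wc by (simp add: embed_prod ww)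
  have eS: "embed z \<bullet>c w (Suc i) = z $ i" if "i < n" for z i
    using that wc by (simp add: embed_prod ww if_distrib cong: if_cong)
  have M0: "(M *\<^sub>v embed z) \<bullet>c w 0 = 0" for z
    using hermitian_cscalar_prod[OF M ec wc[of 0], of z] ec[of z] wc[of 0] e0[of z]
    by (simp add: Mw0 cscalar_prod_smult[of _ ?N])
  have MS: "(M *\<^sub>v embed z) \<bullet>c w (Suc i) = (C *\<^sub>v z) $ i" if i: "i < n" and z: "z \<in> carrier_vec n" for z i
  proof -
    have "(M *\<^sub>v embed z) \<bullet>c w (Suc i) = (\<Sum>j<n. z $ j * (w (Suc j) \<bullet>c (M *\<^sub>v w (Suc i))))"
      using hermitian_cscalar_prod[OF M ec wc[of "Suc i"], of z] i Mc wc[of "Suc i"] by (simp add: embed_prod)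
    also have "\<dots> = (\<Sum>j<n. C $$ (i, j) * z $ j)"
      using i by (intro sum.cong refl) (simp add: C_def hermitian_cscalar_prod[OF M] wc)
    also have "\<dots> = (C *\<^sub>v z) $ i" using i z by (subst mult_mat_vec_sum[of _ n n]) (auto simp: C_def)
    finally show ?thesis .
  qed
  define u where "u = (\<lambda>l. case l of 0 \<Rightarrow> w 0 | Suc l \<Rightarrow> embed (u' l))"
  define d where "d = (\<lambda>l. case l of 0 \<Rightarrow> Re e | Suc l \<Rightarrow> d' l)"
  have ee: "embed (u' l) \<bullet>c embed (u' m) = (if l = m then 1 else 0)" if "l < n" "m < n" for l m
  proof -
    have "w (Suc j) \<bullet>c embed (u' m) = cnj (u' m $ j)" if "j < n" for j
      using cscalar_prod_commute[OF ec wc, of "Suc j" "u' m"] eS[OF that] that by simp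
    then have "embed (u' l) \<bullet>c embed (u' m) = u' l \<bullet>c u' m"
      using u'c that by (simp add: embed_prod[OF ec] cscalar_prod_sum[of _ n])
    then show ?thesis using u' that by (simp add: orthonormal_basis_def)
  qed
  have ew: "w 0 \<bullet>c embed z = 0" for z
    using cscalar_prod_commute[OF ec wc, of 0 z] e0 by simp
  have "orthonormal_basis ?N u"
    unfolding orthonormal_basis_def
  proof (intro conjI allI impI)
    fix l m assume "l < ?N" "m < ?N"
    then show "u l \<bullet>c u m = (if l = m then 1 else 0)"
      by (cases l; cases m) (simp_all add: u_def ee ew e0 ww)
  next
    fix l assume "l < ?N"
    then show "u l \<in> carrier_vec ?N" by (cases l) (simp_all add: u_def ec wc)
  qed
  moreover have "M *\<^sub>v u l = complex_of_real (d l) \<cdot>\<^sub>v u l" if "l < ?N" for l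
  proof (cases l)
    case 0
    then show ?thesis by (simp add: u_def d_def Mw0)
  next
    case (Suc k)
    with that have k: "k < n" by simp
    have "M *\<^sub>v embed (u' k) = complex_of_real (d' k) \<cdot>\<^sub>v embed (u' k)"
    proof (rule orthonormal_basis_eqI[OF w])
      fix i assume i: "i < ?N"
      show "(M *\<^sub>v embed (u' k)) \<bullet>c w i = (complex_of_real (d' k) \<cdot>\<^sub>v embed (u' k)) \<bullet>c w i"
        using i wc[OF i] k u'c[OF k]
        by (cases i) (simp_all add: cscalar_prod_smult[of _ ?N] ec M0 e0 MS eS Cu)
    qed (use Mc ec in auto)
    then show ?thesis using Suc by (simp add: u_def d_def)
  qed
  ultimately show ?case by blast
qed

section \<open>Combinations of matrices and spectral projections\<close>

text \<open>The size is an argument because it fixes the value of the empty combination; entrywise sums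
  avoid an induction over matrix addition in the computations with quadratic forms. The coefficients are
  real since they will be functions of eigenvalues of Hermitian matrices.\<close>

definition lincomb_mat :: "nat \<Rightarrow> (nat \<Rightarrow> real) \<Rightarrow> (nat \<Rightarrow> complex mat) \<Rightarrow> nat \<Rightarrow> complex mat" where
  "lincomb_mat n f G m = mat n n (\<lambda>(i, j). \<Sum>l<m. complex_of_real (f l) * G l $$ (i, j))"

lemma lincomb_mat_carrier [simp]: "lincomb_mat n f G m \<in> carrier_mat n n"
  by (simp add: lincomb_mat_def)

lemma lincomb_mat_index:
  "i < n \<Longrightarrow> j < n \<Longrightarrow> lincomb_mat n f G m $$ (i, j) = (\<Sum>l<m. complex_of_real (f l) * G l $$ (i, j))"
  by (simp add: lincomb_mat_def)

lemma linear_map_lincomb_mat: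
  assumes \<Phi>: "linear_map_mat n k \<Phi>" and G: "\<And>l. l < m \<Longrightarrow> G l \<in> carrier_mat n n"
  shows "\<Phi> (lincomb_mat n f G m) = lincomb_mat k f (\<lambda>l. \<Phi> (G l)) m"
  using G
proof (induction m)
  have car: "\<Phi> M \<in> carrier_mat k k" and add: "\<Phi> (M + N) = \<Phi> M + \<Phi> N" and smult: "\<Phi> (c \<cdot>\<^sub>m M) = c \<cdot>\<^sub>m \<Phi> M"
    if "M \<in> carrier_mat n n" "N \<in> carrier_mat n n" for M N c
    using \<Phi> that by (auto simp: linear_map_mat_iff)
  {
    case 0
    have "lincomb_mat n f G 0 = 0 \<cdot>\<^sub>m 0\<^sub>m n n" by (intro eq_matI) (auto simp: lincomb_mat_def)
    then have "\<Phi> (lincomb_mat n f G 0) = 0 \<cdot>\<^sub>m \<Phi> (0\<^sub>m n n)"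
      by (metis smult zero_carrier_mat)
    also have "\<dots> = lincomb_mat k f (\<lambda>l. \<Phi> (G l)) 0"
      using car[of "0\<^sub>m n n" "0\<^sub>m n n"] by (intro eq_matI) (auto simp: lincomb_mat_def)
    finally show ?case .
  next
    case (Suc m)
    have step: "lincomb_mat p f H (Suc m) = lincomb_mat p f H m + complex_of_real (f m) \<cdot>\<^sub>m H m"
      if "H m \<in> carrier_mat p p" for p H
      using that by (intro eq_matI) (auto simp: lincomb_mat_def)
    have Gm: "G m \<in> carrier_mat n n" using Suc.prems by simp
    show ?case
      using Suc Gm by (simp add: step[where H = G, OF Gm] step[where H = "\<lambda>l. \<Phi> (G l)", OF car[OF Gm Gm]] add smult[OF Gm Gm])
  }
qed

lemma hermitian_lincomb_mat:
  assumes "\<And>l. l < m \<Longrightarrow> hermitian_mat n (G l)"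
  shows "hermitian_mat n (lincomb_mat n f G m)"
  unfolding hermitian_mat_iff
proof (intro conjI allI impI)
  fix i j assume ij: "i < n" "j < n"
  then show "lincomb_mat n f G m $$ (i, j) = cnj (lincomb_mat n f G m $$ (j, i))"
    by (simp add: lincomb_mat_def hermitian_mat_cnj[OF assms])
qed simp

lemma form_lincomb_mat:
  assumes G: "\<And>l. l < m \<Longrightarrow> G l \<in> carrier_mat n n" and v: "v \<in> carrier_vec n" "w \<in> carrier_vec n"
  shows "(lincomb_mat n f G m *\<^sub>v v) \<bullet>c w = (\<Sum>l<m. complex_of_real (f l) * ((G l *\<^sub>v v) \<bullet>c w))"
proof -
  have "(lincomb_mat n f G m *\<^sub>v v) \<bullet>c w
      = (\<Sum>i<n. \<Sum>j<n. \<Sum>l<m. complex_of_real (f l) * (G l $$ (i, j) * v $ j * cnj (w $ i)))"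
    unfolding cscalar_prod_sum[OF v(2)]
    by (intro sum.cong refl)
      (simp add: mult_mat_vec_sum[OF lincomb_mat_carrier v(1)] lincomb_mat_index sum_distrib_right sum_distrib_left mult_ac del: index_mult_mat_vec)
  also have "\<dots> = (\<Sum>i<n. \<Sum>l<m. \<Sum>j<n. complex_of_real (f l) * (G l $$ (i, j) * v $ j * cnj (w $ i)))"
    by (intro sum.cong refl sum.swap)
  also have "\<dots> = (\<Sum>l<m. \<Sum>i<n. \<Sum>j<n. complex_of_real (f l) * (G l $$ (i, j) * v $ j * cnj (w $ i)))"
    by (rule sum.swap)
  also have "\<dots> = (\<Sum>l<m. complex_of_real (f l) * ((G l *\<^sub>v v) \<bullet>c w))"
    unfolding cscalar_prod_sum[OF v(2)]
    by (intro sum.cong refl) (simp add: mult_mat_vec_sum[OF G v(1)] sum_distrib_left sum_distrib_right mult_ac del: index_mult_mat_vec)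
  finally show ?thesis .
qed

lemma psd_mat_iff:
  "psd_mat n M \<longleftrightarrow> hermitian_mat n M \<and> (\<forall>v \<in> carrier_vec n. 0 \<le> Re ((M *\<^sub>v v) \<bullet>c v))"
proof -
  have "Im ((M *\<^sub>v v) \<bullet>c v) = 0" if M: "hermitian_mat n M" and v: "v \<in> carrier_vec n" for v
  proof -
    have "(M *\<^sub>v v) \<bullet>c v = cnj ((M *\<^sub>v v) \<bullet>c v)"
      using hermitian_cscalar_prod[OF M v v] cscalar_prod_commute[of "M *\<^sub>v v" n v] hermitian_mat_carrier[OF M] v
      by simp
    from arg_cong[OF this, of Im] show ?thesis by simp
  qed
  then show ?thesis unfolding psd_mat_def by (auto simp: less_eq_complex_def)
qed

definition rank_one_mat :: "complex vec \<Rightarrow> complex mat" where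
  "rank_one_mat u = mat (dim_vec u) (dim_vec u) (\<lambda>(i, j). u $ i * cnj (u $ j))"

lemma rank_one_mat_mult_vec:
  fixes u v :: "complex vec"
  assumes "u \<in> carrier_vec n" "v \<in> carrier_vec n"
  shows "rank_one_mat u *\<^sub>v v = (v \<bullet>c u) \<cdot>\<^sub>v u"
proof (rule eq_vecI)
  fix i assume "i < dim_vec ((v \<bullet>c u) \<cdot>\<^sub>v u)"
  then have i: "i < n" using assms by simp
  have "rank_one_mat u \<in> carrier_mat n n" using assms by (auto simp: rank_one_mat_def)
  then show "(rank_one_mat u *\<^sub>v v) $ i = ((v \<bullet>c u) \<cdot>\<^sub>v u) $ i"
    using assms i mult_mat_vec_sum[of "rank_one_mat u" n n v i]
    by (simp add: rank_one_mat_def cscalar_prod_sum[of _ n] sum_distrib_left sum_distrib_right mult_ac)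
qed (use assms in \<open>auto simp: rank_one_mat_def\<close>)

lemma psd_rank_one_mat:
  assumes u: "u \<in> carrier_vec n"
  shows "psd_mat n (rank_one_mat u)"
  unfolding psd_mat_iff
proof (intro conjI ballI)
  show "hermitian_mat n (rank_one_mat u)"
    using u by (auto simp: hermitian_mat_iff rank_one_mat_def)
  fix v :: "complex vec" assume v: "v \<in> carrier_vec n"
  have "(rank_one_mat u *\<^sub>v v) \<bullet>c v = (v \<bullet>c u) * cnj (v \<bullet>c u)"
    using u v cscalar_prod_commute[OF v u] by (simp add: rank_one_mat_mult_vec cscalar_prod_smult[of _ n])
  then show "0 \<le> Re ((rank_one_mat u *\<^sub>v v) \<bullet>c v)" by simp
qed

lemma psd_lincomb_mat:
  assumes G: "\<And>l. l < m \<Longrightarrow> psd_mat n (G l)" and f: "\<And>l. l < m \<Longrightarrow> 0 \<le> f l"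
  shows "psd_mat n (lincomb_mat n f G m)"
  using G f unfolding psd_mat_iff
  by (auto intro!: hermitian_lincomb_mat sum_nonneg simp: form_lincomb_mat hermitian_mat_carrier)

text \<open>Multiply the resolution \<open>I = \<Sum>\<^sub>l u\<^sub>l u\<^sub>l\<^sup>*\<close> by \<open>M\<close> from the left. Stated for any matrix diagonal
  in the basis, this writes \<open>I\<close>, \<open>M\<close> and \<open>M\<^sup>2\<close> in terms of the same projections, with coefficients
  \<open>1\<close>, \<open>f l\<close> and \<open>(f l)\<^sup>2\<close>.\<close>

lemma spectral_decomposition:
  assumes u: "orthonormal_basis n u" and M: "M \<in> carrier_mat n n"
    and eig: "\<And>l. l < n \<Longrightarrow> M *\<^sub>v u l = complex_of_real (f l) \<cdot>\<^sub>v u l"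
  shows "M = lincomb_mat n f (\<lambda>l. rank_one_mat (u l)) n"
proof (rule eq_matI)
  fix i j assume "i < dim_row (lincomb_mat n f (\<lambda>l. rank_one_mat (u l)) n)"
    "j < dim_col (lincomb_mat n f (\<lambda>l. rank_one_mat (u l)) n)"
  then have ij: "i < n" "j < n" by (auto simp: lincomb_mat_def)
  note uc = orthonormal_basisD(1)[OF u]
  have "M $$ (i, j) = (\<Sum>k<n. M $$ (i, k) * (if k = j then 1 else 0))"
    using ij by (simp add: if_distrib cong: if_cong)
  also have "\<dots> = (\<Sum>k<n. M $$ (i, k) * (\<Sum>l<n. u l $ k * cnj (u l $ j)))"
    using ij by (intro sum.cong refl) (simp add: orthonormal_basis_resolution[OF u])
  also have "\<dots> = (\<Sum>l<n. (\<Sum>k<n. M $$ (i, k) * u l $ k) * cnj (u l $ j))"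
    unfolding sum_distrib_left sum_distrib_right by (subst sum.swap) (simp add: mult_ac)
  also have "\<dots> = (\<Sum>l<n. (M *\<^sub>v u l) $ i * cnj (u l $ j))"
    using ij by (intro sum.cong refl) (simp add: mult_mat_vec_sum[OF M uc] del: index_mult_mat_vec)
  also have "\<dots> = lincomb_mat n f (\<lambda>l. rank_one_mat (u l)) n $$ (i, j)"
    using ij uc unfolding lincomb_mat_def by (auto simp: eig rank_one_mat_def carrier_vecD[OF uc] mult_ac intro!: sum.cong)
  finally show "M $$ (i, j) = lincomb_mat n f (\<lambda>l. rank_one_mat (u l)) n $$ (i, j)" .
qed (use M in \<open>auto simp: lincomb_mat_def\<close>)

lemma lincomb_rank_one_eigenvector:
  assumes u: "orthonormal_basis n u" and l: "l < n"
  shows "lincomb_mat n f (\<lambda>l. rank_one_mat (u l)) n *\<^sub>v u l = complex_of_real (f l) \<cdot>\<^sub>v u l"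
proof (rule orthonormal_basis_eqI[OF u])
  note uc = orthonormal_basisD(1)[OF u]
  note uu = orthonormal_basisD(4)[OF u]
  show "complex_of_real (f l) \<cdot>\<^sub>v u l \<in> carrier_vec n" using uc l by simp
  show "lincomb_mat n f (\<lambda>l. rank_one_mat (u l)) n *\<^sub>v u l \<in> carrier_vec n"
    by (rule mult_mat_vec_carrier[OF lincomb_mat_carrier uc[OF l]])
  fix k assume k: "k < n"
  have "(lincomb_mat n f (\<lambda>l. rank_one_mat (u l)) n *\<^sub>v u l) \<bullet>c u k
      = (\<Sum>m<n. complex_of_real (f m) * ((rank_one_mat (u m) *\<^sub>v u l) \<bullet>c u k))"
    using uc l k psd_rank_one_mat[OF uc] by (intro form_lincomb_mat) (auto simp: psd_mat_def hermitian_mat_def)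
  also have "\<dots> = (\<Sum>m<n. if m = l then complex_of_real (f l) * (if l = k then 1 else 0) else 0)"
    using l k by (intro sum.cong refl) (simp add: rank_one_mat_mult_vec[of _ n] uc cscalar_prod_smult[of _ n] uu)
  also have "\<dots> = (complex_of_real (f l) \<cdot>\<^sub>v u l) \<bullet>c u k"
    using l k by (simp add: cscalar_prod_smult[of _ n] uc uu)
  finally show "(lincomb_mat n f (\<lambda>l. rank_one_mat (u l)) n *\<^sub>v u l) \<bullet>c u k = (complex_of_real (f l) \<cdot>\<^sub>v u l) \<bullet>c u k" .
qed

section \<open>Positive semidefinite square roots\<close>

lemma psd_sqrt_exists:
  assumes P: "psd_mat n P"
  shows "\<exists>B. psd_mat n B \<and> B * B = P"
proof -
  from P have Ph: "hermitian_mat n P" and Pc: "P \<in> carrier_mat n n" by (auto simp: psd_mat_def hermitian_mat_def)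
  obtain u d where u: "orthonormal_basis n u" and eig: "\<And>l. l < n \<Longrightarrow> P *\<^sub>v u l = complex_of_real (d l) \<cdot>\<^sub>v u l"
    using hermitian_spectral[OF Ph] by blast
  note uc = orthonormal_basisD(1)[OF u]
  have d: "0 \<le> d l" if l: "l < n" for l
  proof -
    have "0 \<le> Re ((P *\<^sub>v u l) \<bullet>c u l)" using P uc[OF l] by (auto simp: psd_mat_iff)
    then show ?thesis using u l uc[OF l] by (simp add: eig cscalar_prod_smult[of _ n] orthonormal_basisD)
  qed
  define B where "B = lincomb_mat n (\<lambda>l. sqrt (d l)) (\<lambda>l. rank_one_mat (u l)) n"
  have Bc: "B \<in> carrier_mat n n" by (simp add: B_def)
  have Bu: "B *\<^sub>v u l = complex_of_real (sqrt (d l)) \<cdot>\<^sub>v u l" if "l < n" for l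
    unfolding B_def by (rule lincomb_rank_one_eigenvector[OF u that])
  have "(B * B) *\<^sub>v u l = complex_of_real (d l) \<cdot>\<^sub>v u l" if l: "l < n" for l
    using d[OF l] by (simp add: assoc_mult_mat_vec[OF Bc Bc uc[OF l]] Bu[OF l] mult_mat_vec[OF Bc uc[OF l]]
        smult_smult_assoc of_real_mult[symmetric] del: of_real_mult)
  then have "B * B = lincomb_mat n d (\<lambda>l. rank_one_mat (u l)) n"
    using Bc by (intro spectral_decomposition[OF u]) auto
  also have "\<dots> = P" using spectral_decomposition[OF u Pc eig] by simp
  finally have "B * B = P" .
  moreover have "psd_mat n B" unfolding B_def using d uc by (intro psd_lincomb_mat psd_rank_one_mat) auto
  ultimately show ?thesis by blast
qed

text \<open>If \<open>(B - C) w = \<delta> w\<close> then \<open>B\<^sup>2 - C\<^sup>2 = B (B - C) + (B - C) C\<close> gives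
  \<open>\<delta> (\<langle>B w, w\<rangle> + \<langle>C w, w\<rangle>) = 0\<close>. For \<open>\<delta> \<noteq> 0\<close> both nonnegative terms vanish, hence
  so does their difference \<open>\<delta> \<langle>w, w\<rangle>\<close>, which is absurd. So \<open>B - C\<close> has only zero eigenvalues.\<close>

lemma psd_sqrt_unique:
  assumes B: "psd_mat n B" and C: "psd_mat n C" and eq: "B * B = C * C"
  shows "B = C"
proof -
  from B C have Bh: "hermitian_mat n B" "hermitian_mat n C" by (auto simp: psd_mat_def)
  then have Bc: "B \<in> carrier_mat n n" "C \<in> carrier_mat n n" by (auto simp: hermitian_mat_def)
  have Dh: "hermitian_mat n (B - C)" using Bh by (rule hermitian_mat_minus)
  obtain u d where u: "orthonormal_basis n u"
    and eig: "\<And>l. l < n \<Longrightarrow> (B - C) *\<^sub>v u l = complex_of_real (d l) \<cdot>\<^sub>v u l"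
    using hermitian_spectral[OF Dh] by blast
  have d0: "d l = 0" if l: "l < n" for l
  proof (rule ccontr)
    assume ne: "d l \<noteq> 0"
    define w where "w = u l"
    have w: "w \<in> carrier_vec n" "w \<bullet>c w = 1" using orthonormal_basisD[OF u l] by (auto simp: w_def)
    have c: "B *\<^sub>v w \<in> carrier_vec n" "C *\<^sub>v w \<in> carrier_vec n" using Bc w by auto
    have dw: "B *\<^sub>v w - C *\<^sub>v w = complex_of_real (d l) \<cdot>\<^sub>v w"
      using eig[OF l] minus_mult_distrib_mat_vec[OF Bc w(1)] by (simp add: w_def)
    have "(B *\<^sub>v w) \<bullet>c (B *\<^sub>v w) = (C *\<^sub>v w) \<bullet>c (C *\<^sub>v w)"
    proof -
      have "(B *\<^sub>v w) \<bullet>c (B *\<^sub>v w) = ((B * B) *\<^sub>v w) \<bullet>c w"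
        using hermitian_cscalar_prod[OF Bh(1) c(1) w(1)] by (simp add: assoc_mult_mat_vec[OF Bc(1) Bc(1) w(1)])
      also have "\<dots> = (C *\<^sub>v w) \<bullet>c (C *\<^sub>v w)"
        unfolding eq using hermitian_cscalar_prod[OF Bh(2) c(2) w(1)] by (simp add: assoc_mult_mat_vec[OF Bc(2) Bc(2) w(1)])
      finally show ?thesis .
    qed
    moreover have "(B *\<^sub>v w) \<bullet>c (B *\<^sub>v w) - (C *\<^sub>v w) \<bullet>c (C *\<^sub>v w)
        = (B *\<^sub>v w) \<bullet>c (B *\<^sub>v w - C *\<^sub>v w) + (B *\<^sub>v w - C *\<^sub>v w) \<bullet>c (C *\<^sub>v w)"
      using c by (simp add: cscalar_prod_minus[of _ n])
    moreover have "w \<bullet>c (C *\<^sub>v w) = (C *\<^sub>v w) \<bullet>c w" using hermitian_cscalar_prod[OF Bh(2) w(1) w(1)] by simp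
    ultimately have "complex_of_real (d l) * ((B *\<^sub>v w) \<bullet>c w + (C *\<^sub>v w) \<bullet>c w) = 0"
      unfolding dw using w c by (simp add: cscalar_prod_smult[of _ n] algebra_simps)
    then have "(B *\<^sub>v w) \<bullet>c w + (C *\<^sub>v w) \<bullet>c w = 0" using ne by simp
    then have "Re ((B *\<^sub>v w) \<bullet>c w) + Re ((C *\<^sub>v w) \<bullet>c w) = 0" by (metis plus_complex.simps(1) zero_complex.simps(1))
    moreover have "Re ((B *\<^sub>v w) \<bullet>c w) \<ge> 0" "Re ((C *\<^sub>v w) \<bullet>c w) \<ge> 0" using B C w by (auto simp: psd_mat_iff)
    ultimately have "Re ((B *\<^sub>v w - C *\<^sub>v w) \<bullet>c w) = 0" using w c by (simp add: cscalar_prod_minus[of _ n])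
    then show False unfolding dw using w ne by (simp add: cscalar_prod_smult[of _ n])
  qed
  have D0: "B - C = lincomb_mat n d (\<lambda>l. rank_one_mat (u l)) n"
    by (rule spectral_decomposition[OF u hermitian_mat_carrier[OF Dh] eig])
  show ?thesis
  proof (rule eq_matI)
    fix i j assume "i < dim_row C" "j < dim_col C"
    then have ij: "i < n" "j < n" using Bc by auto
    have "(B - C) $$ (i, j) = 0" unfolding D0 using ij d0 by (simp add: lincomb_mat_def)
    then show "B $$ (i, j) = C $$ (i, j)" using ij Bc by simp
  qed (use Bc in auto)
qed

lemma psd_sqrt_props:
  assumes "psd_mat n P"
  shows "psd_mat n (psd_sqrt n P)" "psd_sqrt n P * psd_sqrt n P = P"
proof -
  have "\<exists>!B. psd_mat n B \<and> B * B = P" using psd_sqrt_exists[OF assms] psd_sqrt_unique by blast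
  from theI'[OF this] show "psd_mat n (psd_sqrt n P)" "psd_sqrt n P * psd_sqrt n P = P"
    unfolding psd_sqrt_def by auto
qed

text \<open>A pointwise form of the monotonicity of the square root against scalars: for \<open>c > 0\<close> expand
  \<open>0 \<le> \<parallel>B v - c v\<parallel>\<^sup>2\<close> and use \<open>\<parallel>B v\<parallel>\<^sup>2 \<le> c\<^sup>2 \<parallel>v\<parallel>\<^sup>2\<close>.\<close>

lemma psd_le_of_square_le:
  assumes B: "psd_mat n B" and c: "0 \<le> c" and v: "v \<in> carrier_vec n"
    and sq: "Re ((B * B *\<^sub>v v) \<bullet>c v) \<le> c\<^sup>2 * Re (v \<bullet>c v)"
  shows "Re ((B *\<^sub>v v) \<bullet>c v) \<le> c * Re (v \<bullet>c v)"
proof -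
  from B have Bh: "hermitian_mat n B" and Bc: "B \<in> carrier_mat n n" by (auto simp: psd_mat_def hermitian_mat_def)
  have Bv: "B *\<^sub>v v \<in> carrier_vec n" using Bc v by auto
  have sq': "Re ((B *\<^sub>v v) \<bullet>c (B *\<^sub>v v)) \<le> c\<^sup>2 * Re (v \<bullet>c v)"
    using sq hermitian_cscalar_prod[OF Bh Bv v] by (simp add: assoc_mult_mat_vec[OF Bc Bc v])
  show ?thesis
  proof (cases "c = 0")
    case True
    then have "Re ((B *\<^sub>v v) \<bullet>c (B *\<^sub>v v)) = 0" using sq' cscalar_prod_self_Re(2)[OF Bv] by simp
    then have "(B *\<^sub>v v) \<bullet>c (B *\<^sub>v v) = 0" by (subst cscalar_prod_self_Re(1)[OF Bv]) simp
    then have "B *\<^sub>v v = 0\<^sub>v n" using Bv by simp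
    then show ?thesis using True v by simp
  next
    case False
    let ?w = "B *\<^sub>v v - complex_of_real c \<cdot>\<^sub>v v"
    have "0 \<le> Re (?w \<bullet>c ?w)" using Bv v by (intro cscalar_prod_self_Re(2)[of _ n]) auto
    also have "?w \<bullet>c ?w = (B *\<^sub>v v) \<bullet>c (B *\<^sub>v v) - 2 * c * ((B *\<^sub>v v) \<bullet>c v) + c * c * (v \<bullet>c v)"
      using Bv v hermitian_cscalar_prod[OF Bh v v]
      by (simp add: cscalar_prod_minus[of _ n] cscalar_prod_smult[of _ n] algebra_simps)
    finally have "0 \<le> Re ((B *\<^sub>v v) \<bullet>c (B *\<^sub>v v)) - 2 * c * Re ((B *\<^sub>v v) \<bullet>c v) + c\<^sup>2 * Re (v \<bullet>c v)"
      by (simp add: power2_eq_square)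
    with sq' have "c * Re ((B *\<^sub>v v) \<bullet>c v) \<le> c * (c * Re (v \<bullet>c v))" by (simp add: power2_eq_square algebra_simps)
    then show ?thesis using c False by simp
  qed
qed

section \<open>The operator variance\<close>

text \<open>Positive semidefinite matrices \<open>G l\<close> with sum \<open>I\<close> act like a probability distribution on the
  points \<open>d l\<close>, with mean \<open>H\<close> and variance \<open>H2 - H\<^sup>2\<close>. The variance is nonnegative (for images under a
  positive unital map this is Kadison's inequality), and on an interval of length \<open>M - m\<close> it is
  at most \<open>((M - m) / 2)\<^sup>2\<close> (the inequality of Popoviciu). The two scalar proofs carry over
  because the expectations in them become sums of values of the nonnegative forms \<open>G l\<close>.\<close>

lemma psd_resolution_variance:
  fixes d :: "nat \<Rightarrow> real" and m M :: real
  assumes G: "\<And>l. l < n \<Longrightarrow> psd_mat k (G l)" and one: "lincomb_mat k (\<lambda>_. 1) G n = 1\<^sub>m k"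
  defines "H \<equiv> lincomb_mat k d G n" and "H2 \<equiv> lincomb_mat k (\<lambda>l. (d l)\<^sup>2) G n"
  shows "psd_mat k (H2 - H * H)"
    and "\<And>v. (\<And>l. l < n \<Longrightarrow> m \<le> d l \<and> d l \<le> M) \<Longrightarrow> v \<in> carrier_vec k \<Longrightarrow>
      Re (((H2 - H * H) *\<^sub>v v) \<bullet>c v) \<le> ((M - m) / 2)\<^sup>2 * Re (v \<bullet>c v)"
proof -
  have Gh: "hermitian_mat k (G l)" and Gc: "G l \<in> carrier_mat k k" if "l < n" for l
    using G[OF that] by (auto simp: psd_mat_def hermitian_mat_def)
  have Hh: "hermitian_mat k H" "hermitian_mat k H2" using Gh by (auto simp: H_def H2_def intro: hermitian_lincomb_mat)
  then have Hc: "H \<in> carrier_mat k k" "H2 \<in> carrier_mat k k" by (auto simp: hermitian_mat_def)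
  have I: "(\<Sum>l<n. (G l *\<^sub>v v) \<bullet>c w) = v \<bullet>c w" and HI: "(\<Sum>l<n. d l * ((G l *\<^sub>v v) \<bullet>c w)) = (H *\<^sub>v v) \<bullet>c w"
    and H2I: "(\<Sum>l<n. d l * d l * ((G l *\<^sub>v v) \<bullet>c w)) = (H2 *\<^sub>v v) \<bullet>c w"
    if "v \<in> carrier_vec k" "w \<in> carrier_vec k" for v w
    using form_lincomb_mat[where m = n and G = G and f = "\<lambda>_. 1", OF Gc that] form_lincomb_mat[where m = n and G = G and f = d, OF Gc that]
      form_lincomb_mat[where m = n and G = G and f = "\<lambda>l. (d l)\<^sup>2", OF Gc that] one that
    by (simp_all add: H_def H2_def power2_eq_square)
  have form: "((H2 - H * H) *\<^sub>v v) \<bullet>c v = (H2 *\<^sub>v v) \<bullet>c v - (H *\<^sub>v v) \<bullet>c (H *\<^sub>v v)" if v: "v \<in> carrier_vec k" for v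
    using hermitian_cscalar_prod[OF Hh(1), of "H *\<^sub>v v" v] Hc v
    by (simp add: minus_mult_distrib_mat_vec[of _ k k] assoc_mult_mat_vec[OF Hc(1) Hc(1) v] cscalar_prod_minus[of _ k])
  have "hermitian_mat k (H2 - H * H)" using Hh by (intro hermitian_mat_minus hermitian_mat_square)
  moreover have "0 \<le> Re (((H2 - H * H) *\<^sub>v v) \<bullet>c v)" if v: "v \<in> carrier_vec k" for v
  proof -
    define w where "w = H *\<^sub>v v"
    have w: "w \<in> carrier_vec k" using Hc v by (simp add: w_def)
    let ?x = "\<lambda>l. complex_of_real (d l) \<cdot>\<^sub>v v - w"
    \<comment> \<open>the expectation of \<open>(d - mean)\<^sup>2\<close>\<close>
    have "0 \<le> (\<Sum>l<n. Re ((G l *\<^sub>v ?x l) \<bullet>c ?x l))"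
      using G v w by (intro sum_nonneg) (auto simp: psd_mat_iff)
    also have "\<dots> = Re (\<Sum>l<n. (G l *\<^sub>v ?x l) \<bullet>c ?x l)" by simp
    also have "(\<Sum>l<n. (G l *\<^sub>v ?x l) \<bullet>c ?x l) = (\<Sum>l<n. d l * d l * ((G l *\<^sub>v v) \<bullet>c v) - d l * ((G l *\<^sub>v v) \<bullet>c w)
        - d l * ((G l *\<^sub>v w) \<bullet>c v) + (G l *\<^sub>v w) \<bullet>c w)"
    proof (intro sum.cong refl)
      fix l assume "l \<in> {..<n}"
      then have g: "G l \<in> carrier_mat k k" using Gc by simp
      then have gc: "G l *\<^sub>v v \<in> carrier_vec k" "G l *\<^sub>v w \<in> carrier_vec k" using v w by auto
      have "G l *\<^sub>v ?x l = complex_of_real (d l) \<cdot>\<^sub>v (G l *\<^sub>v v) - G l *\<^sub>v w"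
        using g v w by (simp add: mult_minus_distrib_mat_vec[of _ k k] mult_mat_vec[of _ k k])
      then show "(G l *\<^sub>v ?x l) \<bullet>c ?x l = d l * d l * ((G l *\<^sub>v v) \<bullet>c v) - d l * ((G l *\<^sub>v v) \<bullet>c w)
        - d l * ((G l *\<^sub>v w) \<bullet>c v) + (G l *\<^sub>v w) \<bullet>c w"
        using gc v w by (simp add: cscalar_prod_minus[of _ k] cscalar_prod_smult[of _ k] algebra_simps)
    qed
    also have "\<dots> = (H2 *\<^sub>v v) \<bullet>c v - (H *\<^sub>v v) \<bullet>c w - (H *\<^sub>v w) \<bullet>c v + w \<bullet>c w"
      using v w H2I[OF v v] by (simp add: sum.distrib sum_subtractf I HI)
    also have "(H *\<^sub>v w) \<bullet>c v = w \<bullet>c w" using hermitian_cscalar_prod[OF Hh(1) w v] by (simp add: w_def)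
    finally show ?thesis by (simp add: form[OF v] w_def)
  qed
  ultimately show "psd_mat k (H2 - H * H)" by (simp add: psd_mat_iff)
  fix v :: "complex vec" assume mM: "\<And>l. l < n \<Longrightarrow> m \<le> d l \<and> d l \<le> M" and v: "v \<in> carrier_vec k"
  define w where "w = H *\<^sub>v v"
  have w: "w \<in> carrier_vec k" using Hc v by (simp add: w_def)
  \<comment> \<open>the expectation of \<open>(M - d) (d - m)\<close>, and below the square of the distance of the mean
    from the midpoint\<close>
  have "0 \<le> (\<Sum>l<n. (M - d l) * (d l - m) * Re ((G l *\<^sub>v v) \<bullet>c v))"
    using G v mM by (intro sum_nonneg mult_nonneg_nonneg) (auto simp: psd_mat_iff)
  also have "\<dots> = Re (\<Sum>l<n. (M + m) * (d l * ((G l *\<^sub>v v) \<bullet>c v)) - M * m * ((G l *\<^sub>v v) \<bullet>c v)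
      - d l * d l * ((G l *\<^sub>v v) \<bullet>c v))"
    unfolding Re_sum by (intro sum.cong refl) (simp add: algebra_simps)
  also have "\<dots> = (M + m) * Re (w \<bullet>c v) - M * m * Re (v \<bullet>c v) - Re ((H2 *\<^sub>v v) \<bullet>c v)"
    unfolding sum_subtractf sum_distrib_left[symmetric] I[OF v v] HI[OF v v] H2I[OF v v] by (simp add: w_def algebra_simps)
  finally have 1: "Re ((H2 *\<^sub>v v) \<bullet>c v) \<le> (M + m) * Re (w \<bullet>c v) - M * m * Re (v \<bullet>c v)" by simp
  define c where "c = (M + m) / 2"
  let ?y = "w - complex_of_real c \<cdot>\<^sub>v v"
  have "v \<bullet>c w = w \<bullet>c v" using hermitian_cscalar_prod[OF Hh(1) v v] by (simp add: w_def)
  then have "?y \<bullet>c ?y = w \<bullet>c w - 2 * complex_of_real c * (w \<bullet>c v) + complex_of_real c * complex_of_real c * (v \<bullet>c v)"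
    using v w by (simp add: cscalar_prod_minus[of _ k] cscalar_prod_smult[of _ k] algebra_simps)
  then have "Re (?y \<bullet>c ?y) = Re (w \<bullet>c w) - 2 * c * Re (w \<bullet>c v) + c\<^sup>2 * Re (v \<bullet>c v)"
    by (simp add: power2_eq_square)
  moreover have "0 \<le> Re (?y \<bullet>c ?y)" using v w by (intro cscalar_prod_self_Re(2)[of _ k]) auto
  moreover have "M + m = 2 * c" by (simp add: c_def)
  ultimately have "(M + m) * Re (w \<bullet>c v) - Re (w \<bullet>c w) \<le> c\<^sup>2 * Re (v \<bullet>c v)" by simp
  with 1 have "Re ((H2 *\<^sub>v v) \<bullet>c v) - Re (w \<bullet>c w) \<le> (c\<^sup>2 - M * m) * Re (v \<bullet>c v)"
    by (simp add: left_diff_distrib)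
  also have "c\<^sup>2 - M * m = ((M - m) / 2)\<^sup>2" by (simp add: c_def power2_eq_square field_simps)
  finally show "Re (((H2 - H * H) *\<^sub>v v) \<bullet>c v) \<le> ((M - m) / 2)\<^sup>2 * Re (v \<bullet>c v)"
    by (simp add: form[OF v] w_def)
qed

section \<open>Entrywise domination and the spectral radius\<close>

lemma pow_mat_dominated:
  assumes X: "X \<in> carrier_mat n n" and A: "A \<in> carrier_mat n n"
    and le: "\<And>i j. i < n \<Longrightarrow> j < n \<Longrightarrow> complex_of_real (cmod (X $$ (i, j))) \<le> A $$ (i, j)"
    and ij: "i < n" "j < n"
  shows "complex_of_real (cmod ((X ^\<^sub>m k) $$ (i, j))) \<le> (A ^\<^sub>m k) $$ (i, j)"
  using ij
proof (induction k arbitrary: i j)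
  case 0
  then show ?case using X A by simp
next
  case (Suc k)
  note [simp] = less_eq_complex_def
  have "cmod ((X ^\<^sub>m k * X) $$ (i, j)) \<le> (\<Sum>l<n. cmod ((X ^\<^sub>m k) $$ (i, l)) * cmod (X $$ (l, j)))"
    unfolding mult_mat_sum[OF pow_carrier_mat[OF X] X Suc.prems] by (rule order_trans[OF norm_sum]) (simp add: norm_mult)
  also have "\<dots> \<le> (\<Sum>l<n. Re ((A ^\<^sub>m k) $$ (i, l)) * Re (A $$ (l, j)))"
  proof (intro sum_mono mult_mono)
    fix l assume "l \<in> {..<n}"
    then have l: "l < n" by simp
    show "cmod ((X ^\<^sub>m k) $$ (i, l)) \<le> Re ((A ^\<^sub>m k) $$ (i, l))" "cmod (X $$ (l, j)) \<le> Re (A $$ (l, j))"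
      using Suc.IH[OF Suc.prems(1) l] le[OF l Suc.prems(2)] by auto
    then show "0 \<le> Re ((A ^\<^sub>m k) $$ (i, l))" by (meson norm_ge_zero order_trans)
  qed auto
  finally have "cmod ((X ^\<^sub>m k * X) $$ (i, j)) \<le> (\<Sum>l<n. Re ((A ^\<^sub>m k) $$ (i, l)) * Re (A $$ (l, j)))" .
  moreover have "(A ^\<^sub>m k * A) $$ (i, j) = complex_of_real (\<Sum>l<n. Re ((A ^\<^sub>m k) $$ (i, l)) * Re (A $$ (l, j)))"
    unfolding mult_mat_sum[OF pow_carrier_mat[OF A] A Suc.prems] of_real_sum
  proof (intro sum.cong refl)
    fix l assume "l \<in> {..<n}"
    then have l: "l < n" by simp
    show "(A ^\<^sub>m k) $$ (i, l) * A $$ (l, j) = complex_of_real (Re ((A ^\<^sub>m k) $$ (i, l)) * Re (A $$ (l, j)))"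
      using Suc.IH[OF Suc.prems(1) l] le[OF l Suc.prems(2)] by (simp add: complex_eq_iff)
  qed
  ultimately show ?case by simp
qed

text \<open>Were the claim false, a scalar \<open>s\<close> strictly between \<open>spectral_radius A\<close> and \<open>cmod \<mu>\<close> would exist.
  The powers of \<open>A / s\<close> are bounded because its spectral radius is below 1, hence so are the
  powers of \<open>X / s\<close>, which they dominate entrywise. But \<open>X / s\<close> has an eigenvalue of modulus
  above 1, so its powers grow geometrically on an eigenvector.\<close>

theorem eigenvalue_le_spectral_radius_dominating:
  assumes X: "X \<in> carrier_mat n n" and A: "A \<in> carrier_mat n n"
    and le: "\<And>i j. i < n \<Longrightarrow> j < n \<Longrightarrow> complex_of_real (cmod (X $$ (i, j))) \<le> A $$ (i, j)"
    and ev: "eigenvalue X \<mu>"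
  shows "cmod \<mu> \<le> spectral_radius A"
proof (rule ccontr)
  assume "\<not> ?thesis"
  then have lt: "spectral_radius A < cmod \<mu>" by simp
  have n: "n > 0" using eigenvalue_imp_nonzero_dim[OF X ev] .
  have rho: "cmod a \<le> spectral_radius A" if "eigenvalue A a" for a
    using spectral_radius_mem_max(2)[OF A n] that by (auto simp: spectrum_def)
  have rho0: "0 \<le> spectral_radius A" using spectral_radius_mem_max(1)[OF A n] by auto
  obtain s where s: "spectral_radius A < s" "s < cmod \<mu>" using dense[OF lt] by auto
  then have s0: "s > 0" using rho0 by simp
  define A' X' where "A' = complex_of_real (1 / s) \<cdot>\<^sub>m A" and "X' = complex_of_real (1 / s) \<cdot>\<^sub>m X"
  have A': "A' \<in> carrier_mat n n" and X': "X' \<in> carrier_mat n n" using A X by (auto simp: A'_def X'_def)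
  have smult: "(c \<cdot>\<^sub>m B) *\<^sub>v v = c \<cdot>\<^sub>v (B *\<^sub>v v)"
    if "B \<in> carrier_mat n n" "v \<in> carrier_vec n" for c :: complex and B v
    using that by (intro eq_vecI) (auto simp: scalar_prod_def sum_distrib_left mult_ac)
  have "spectral_radius A' < 1"
  proof -
    obtain a where a: "eigenvalue A' a" "spectral_radius A' = cmod a"
      using spectral_radius_mem_max(1)[OF A' n] by (auto simp: spectrum_def)
    then obtain v where v: "v \<in> carrier_vec n" "v \<noteq> 0\<^sub>v n" "A' *\<^sub>v v = a \<cdot>\<^sub>v v"
      using A' by (auto simp: eigenvalue_def eigenvector_def)
    have "A *\<^sub>v v = complex_of_real s \<cdot>\<^sub>v (A' *\<^sub>v v)"
      unfolding A'_def smult[OF A v(1)] smult_smult_assoc using s0 by simp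
    then have "A *\<^sub>v v = (complex_of_real s * a) \<cdot>\<^sub>v v" by (simp add: v(3) smult_smult_assoc)
    then have "eigenvalue A (complex_of_real s * a)"
      using v A by (auto simp: eigenvalue_def eigenvector_def)
    from rho[OF this] have "s * cmod a \<le> spectral_radius A" using s0 by (simp add: norm_mult)
    also have "\<dots> < s * 1" using s by simp
    finally show ?thesis using s0 a by (simp only: mult_less_cancel_left_pos)
  qed
  from spectral_radius_jnf_norm_bound_less_1_upper_triangular[OF A' this]
  obtain b where b: "\<And>k. norm_bound (A' ^\<^sub>m k) b" by auto
  have le': "complex_of_real (cmod (X' $$ (i, j))) \<le> A' $$ (i, j)" if "i < n" "j < n" for i j
    using le[OF that] that A X s0
    by (auto simp: A'_def X'_def less_eq_complex_def norm_mult norm_divide divide_right_mono)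
  have Xb: "cmod ((X' ^\<^sub>m k) $$ (i, j)) \<le> b" if "i < n" "j < n" for i j k
  proof -
    have "cmod ((X' ^\<^sub>m k) $$ (i, j)) \<le> cmod ((A' ^\<^sub>m k) $$ (i, j))"
      using pow_mat_dominated[OF X' A' le' that, of k] complex_Re_le_cmod[of "(A' ^\<^sub>m k) $$ (i, j)"]
      by (simp add: less_eq_complex_def)
    also have "\<dots> \<le> b" using b[of k] that A' by (auto simp: norm_bound_def split: if_splits)
    finally show ?thesis .
  qed
  obtain v where v: "v \<in> carrier_vec n" "v \<noteq> 0\<^sub>v n" "X *\<^sub>v v = \<mu> \<cdot>\<^sub>v v"
    using ev X by (auto simp: eigenvalue_def eigenvector_def)
  define \<nu> where "\<nu> = complex_of_real (1 / s) * \<mu>"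
  have "eigenvector X' v \<nu>"
    using v X X' unfolding eigenvector_def by (simp add: X'_def smult \<nu>_def smult_smult_assoc)
  then have pow: "X' ^\<^sub>m k *\<^sub>v v = \<nu> ^ k \<cdot>\<^sub>v v" for k by (rule eigenvector_pow[OF X'])
  obtain i where i: "i < n" "v $ i \<noteq> 0" using v(1,2) by (metis carrier_vecD eq_vecI index_zero_vec)
  define K where "K = (\<Sum>j<n. b * cmod (v $ j))"
  have bound: "cmod \<nu> ^ k * cmod (v $ i) \<le> K" for k
  proof -
    have "\<nu> ^ k * v $ i = (\<Sum>j<n. (X' ^\<^sub>m k) $$ (i, j) * v $ j)"
      using arg_cong[OF pow[of k], of "\<lambda>w. w $ i"] mult_mat_vec_sum[OF pow_carrier_mat[OF X'] v(1) i(1), of k] v(1) i(1)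
      by simp
    then have "cmod \<nu> ^ k * cmod (v $ i) \<le> (\<Sum>j<n. cmod ((X' ^\<^sub>m k) $$ (i, j)) * cmod (v $ j))"
      by (metis (mono_tags, lifting) norm_mult norm_power norm_sum sum.cong)
    also have "\<dots> \<le> K" unfolding K_def using Xb i by (intro sum_mono mult_right_mono) auto
    finally show ?thesis .
  qed
  have "cmod \<nu> > 1" using s s0 by (simp add: \<nu>_def norm_mult norm_divide)
  from real_arch_pow[OF this, of "K / cmod (v $ i)"] obtain k where "K / cmod (v $ i) < cmod \<nu> ^ k" by auto
  then have "K < cmod \<nu> ^ k * cmod (v $ i)" using i by (simp add: divide_less_eq)
  with bound[of k] show False by simp
qed

section \<open>Diagonal entries and the extreme eigenvalues\<close>

lemma sort_two_smallest_le:
  fixes xs :: "'a::{linorder, ordered_ab_semigroup_add} list"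
  assumes i: "i < length xs" and j: "j < length xs" and ij: "i \<noteq> j"
  shows "sort xs ! 0 + sort xs ! 1 \<le> xs ! i + xs ! j"
proof -
  obtain p where p: "p permutes {..<length (sort xs)}" "permute_list p (sort xs) = xs"
    using mset_eq_permutation[of xs "sort xs"] by auto
  have nth: "xs ! l = sort xs ! p l" "p l < length xs" if "l < length xs" for l
    using permute_list_nth[OF p(1), of l] permutes_in_image[OF p(1), of l] that p(2) by auto
  have ne: "p i \<noteq> p j" using permutes_inj[OF p(1)] ij by (auto dest: injD)
  have *: "sort xs ! 0 + sort xs ! 1 \<le> sort xs ! a + sort xs ! b"
    if "a < b" "b < length xs" for a b
    using that by (intro add_mono sorted_nth_mono) auto
  show ?thesis
    using *[of "p i" "p j"] *[of "p j" "p i"] nth(1)[OF i] nth(1)[OF j] nth(2)[OF i] nth(2)[OF j] ne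
    by (cases "p i < p j") (auto simp: add.commute)
qed

lemma nonneg_eigenvector_diagonal_le:
  fixes x :: "nat \<Rightarrow> nat \<Rightarrow> real"
  assumes x: "\<And>i j. i < n \<Longrightarrow> j < n \<Longrightarrow> 0 \<le> x i j" and z: "\<And>j. j < n \<Longrightarrow> 0 \<le> z j"
    and i: "i < n" "0 < z i" and eig: "(\<Sum>j<n. x i j * z j) = m * z i"
  shows "x i i \<le> m"
proof -
  have "x i i * z i \<le> (\<Sum>j<n. x i j * z j)" using x z i by (intro member_le_sum) auto
  then show ?thesis using i eig by simp
qed

text \<open>Here \<open>M\<close> bounds the quadratic form of \<open>x\<close> and \<open>m\<close> is an eigenvalue with real eigenvector
  \<open>z = zp - zn\<close>, split into positive and negative part.

  If both parts are nonzero, with squared norms \<open>a\<close> and \<open>b\<close>, the vectors \<open>z\<close> and \<open>b zp + a zn\<close>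
  form an orthogonal basis of the plane spanned by \<open>zp\<close> and \<open>zn\<close>. The form restricted to this plane
  has a trace that does not depend on the basis: in the first basis it is at most \<open>m + M\<close>, in
  the second one it is \<open>Q zp zp / a + Q zn zn / b\<close>. As all entries are nonnegative, each of these quotients
  is at least an average of diagonal entries, over the disjoint supports of \<open>zp\<close> and \<open>zn\<close>.

  If \<open>z\<close> has constant sign, then already \<open>x i i \<le> m\<close> for an index \<open>i\<close> in its support, while every
  other diagonal entry is at most \<open>M\<close>.\<close>

theorem two_diagonal_entries_le:
  fixes x :: "nat \<Rightarrow> nat \<Rightarrow> real" and z :: "nat \<Rightarrow> real"
  assumes n: "n \<ge> 2"
    and x: "\<And>i j. i < n \<Longrightarrow> j < n \<Longrightarrow> 0 \<le> x i j"
    and eig: "\<And>i. i < n \<Longrightarrow> (\<Sum>j<n. x i j * z j) = m * z i" and z: "i0 < n" "z i0 \<noteq> 0"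
    and form: "\<And>y. (\<Sum>i<n. \<Sum>j<n. x i j * y i * y j) \<le> M * (\<Sum>i<n. (y i)\<^sup>2)"
  shows "\<exists>i<n. \<exists>j<n. i \<noteq> j \<and> x i i + x j j \<le> M + m"
proof -
  define pos neg where "pos = {i. i < n \<and> z i > 0}" and "neg = {i. i < n \<and> z i < 0}"
  have fin: "finite pos" "finite neg" by (auto simp: pos_def neg_def)
  show ?thesis
  proof (cases "pos = {} \<or> neg = {}")
    case True
    obtain s :: real where s: "s = 1 \<or> s = -1" "\<And>i. i < n \<Longrightarrow> 0 \<le> s * z i"
    proof (cases "neg = {}")
      case True then show ?thesis using that[of 1] by (fastforce simp: neg_def)
    next
      case False then show ?thesis using True that[of "-1"] by (fastforce simp: pos_def)
    qed
    have "0 < s * z i0" using s(1) s(2)[OF z(1)] z(2) by fastforce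
    moreover have "(\<Sum>j<n. x i0 j * (s * z j)) = m * (s * z i0)"
      using eig[OF z(1)] by (simp add: sum_distrib_left[symmetric] mult.left_commute[of _ s])
    ultimately have "x i0 i0 \<le> m"
      using nonneg_eigenvector_diagonal_le[of n x "\<lambda>i. s * z i" i0 m] x s(2) z(1) by blast
    moreover have "x j j \<le> M" if "j < n" for j
      using form[of "\<lambda>i. if i = j then 1 else 0"] that
      by (simp add: if_distrib[of "\<lambda>a. _ * a"] if_distrib[of "\<lambda>a. a ^ 2"] cong: if_cong)
    moreover define j :: nat where "j = (if i0 = 0 then 1 else 0)"
    moreover have "j < n" "j \<noteq> i0" using n by (auto simp: j_def)
    ultimately show ?thesis using z(1) by (metis add.commute add_mono)
  next
    case False
    define zp zn where "zp = (\<lambda>i. max (z i) 0)" and "zn = (\<lambda>i. max (- z i) 0)"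
    define Q where "Q = (\<lambda>y w. \<Sum>i<n. \<Sum>j<n. x i j * y i * w j)"
    define a b where "a = (\<Sum>i<n. (zp i)\<^sup>2)" and "b = (\<Sum>i<n. (zn i)\<^sup>2)"
    have Q: "Q (\<lambda>i. s * y i + t * w i) (\<lambda>i. s * y i + t * w i)
        = s\<^sup>2 * Q y y + s * t * (Q y w + Q w y) + t\<^sup>2 * Q w w" for s t y w
      unfolding Q_def sum_distrib_left sum.distrib[symmetric]
      by (intro sum.cong refl) (simp add: algebra_simps power2_eq_square)
    have zpn: "z i = zp i - zn i" "zp i * zn i = 0" for i by (auto simp: zp_def zn_def max_def)
    have norm: "(\<Sum>i<n. (s * zp i + t * zn i)\<^sup>2) = s\<^sup>2 * a + t\<^sup>2 * b" for s t
    proof -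
      have "(s * zp i + t * zn i)\<^sup>2 = s\<^sup>2 * (zp i)\<^sup>2 + t\<^sup>2 * (zn i)\<^sup>2" for i
        using zpn(2)[of i] by (auto simp: power_mult_distrib)
      then show ?thesis by (simp add: a_def b_def sum.distrib sum_distrib_left)
    qed
    define r where "r = Q zp zn + Q zn zp"
    have "Q z z = (\<Sum>i<n. z i * (\<Sum>j<n. x i j * z j))"
      unfolding Q_def by (simp add: sum_distrib_left mult_ac)
    also have "\<dots> = m * (\<Sum>i<n. (z i)\<^sup>2)"
      unfolding sum_distrib_left[of m] by (intro sum.cong refl) (simp add: eig power2_eq_square)
    finally have e1: "Q zp zp - r + Q zn zn = m * (a + b)"
      using Q[of 1 zp "-1" zn] norm[of 1 "-1"] by (simp add: r_def zpn(1)[symmetric])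
    have e2: "b\<^sup>2 * Q zp zp + a * b * r + a\<^sup>2 * Q zn zn \<le> M * (b\<^sup>2 * a + a\<^sup>2 * b)"
      using form[of "\<lambda>i. b * zp i + a * zn i"] unfolding norm Q_def[symmetric]
      using Q[of b zp a zn] by (simp add: r_def Q_def mult_ac)
    have a0: "a > 0"
    proof -
      obtain i where "i < n" "z i > 0" using False by (auto simp: pos_def)
      then show ?thesis unfolding a_def by (intro sum_pos2[of _ i]) (auto simp: zp_def)
    qed
    have b0: "b > 0"
    proof -
      obtain i where "i < n" "z i < 0" using False by (auto simp: neg_def)
      then show ?thesis unfolding b_def by (intro sum_pos2[of _ i]) (auto simp: zn_def)
    qed
    \<comment> \<open>in the trace the mixed terms \<open>r\<close> cancel\<close>
    have "a * b * (Q zp zp - r + Q zn zn) + (b\<^sup>2 * Q zp zp + a * b * r + a\<^sup>2 * Q zn zn)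
        \<le> a * b * (m * (a + b)) + M * (b\<^sup>2 * a + a\<^sup>2 * b)" using e1 e2 by simp
    then have "(a + b) * (b * Q zp zp + a * Q zn zn) \<le> (a + b) * ((M + m) * (a * b))"
      by (simp add: algebra_simps power2_eq_square)
    then have e3: "b * Q zp zp + a * Q zn zn \<le> (M + m) * (a * b)"
      using a0 b0 by (simp add: mult_le_cancel_left_pos)
    have diag: "\<exists>k\<in>S. x k k * (\<Sum>i<n. (y i)\<^sup>2) \<le> Q y y"
      if S: "finite S" "S \<noteq> {}" "S \<subseteq> {..<n}" and y: "\<And>i. 0 \<le> y i" "\<And>i. i < n \<Longrightarrow> i \<notin> S \<Longrightarrow> y i = 0" for S y
    proof -
      define k where "k = arg_min_on (\<lambda>i. x i i) S"
      have k: "k \<in> S" "\<And>i. i \<in> S \<Longrightarrow> x k k \<le> x i i"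
        using arg_min_if_finite(1)[OF S(1,2)] arg_min_least[OF S(1,2)] by (auto simp: k_def)
      have "x k k * (\<Sum>i<n. (y i)\<^sup>2) \<le> (\<Sum>i<n. x i i * y i * y i)"
        unfolding sum_distrib_left
      proof (intro sum_mono)
        fix i assume "i \<in> {..<n}"
        then show "x k k * (y i)\<^sup>2 \<le> x i i * y i * y i"
          using k(2)[of i] y(2)[of i]
          by (cases "i \<in> S") (auto simp: power2_eq_square mult.assoc intro!: mult_right_mono)
      qed
      also have "\<dots> \<le> Q y y"
        unfolding Q_def using x y(1) by (intro sum_mono member_le_sum) auto
      finally show ?thesis using k(1) by blast
    qed
    obtain i where i: "i \<in> pos" "x i i * a \<le> Q zp zp"
      using diag[of pos zp] False fin unfolding a_def by (auto simp: pos_def zp_def)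
    obtain j where j: "j \<in> neg" "x j j * b \<le> Q zn zn"
      using diag[of neg zn] False fin unfolding b_def by (auto simp: neg_def zn_def)
    have "(x i i + x j j) * (a * b) = b * (x i i * a) + a * (x j j * b)" by (simp add: algebra_simps)
    also have "\<dots> \<le> b * Q zp zp + a * Q zn zn"
      using i j a0 b0 by (intro add_mono mult_left_mono) auto
    also note e3
    finally have "x i i + x j j \<le> M + m" using a0 b0 by simp
    moreover have "i < n" "j < n" "i \<noteq> j" using i j by (auto simp: pos_def neg_def)
    ultimately show ?thesis by blast
  qed
qed

text \<open>The real and the imaginary part of an eigenvector of a real matrix to a real eigenvalue
  satisfy the eigenvector equation separately, and one of them is nonzero.\<close>

lemma real_eigenvector_of_real_matrix:
  assumes X: "X \<in> carrier_mat n n" and real: "\<And>i j. i < n \<Longrightarrow> j < n \<Longrightarrow> X $$ (i, j) = complex_of_real (x i j)"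
    and v: "v \<in> carrier_vec n" "v \<noteq> 0\<^sub>v n" and eig: "X *\<^sub>v v = complex_of_real m \<cdot>\<^sub>v v"
  obtains z i where "i < n" "z i \<noteq> 0" "\<And>i. i < n \<Longrightarrow> (\<Sum>j<n. x i j * z j) = m * z i"
proof -
  have e: "(\<Sum>j<n. complex_of_real (x i j) * v $ j) = complex_of_real m * v $ i" if i: "i < n" for i
    using arg_cong[OF eig, of "\<lambda>w. w $ i"] mult_mat_vec_sum[OF X v(1) i] v(1) i real[OF i] by simp
  have Re: "(\<Sum>j<n. x i j * Re (v $ j)) = m * Re (v $ i)" if "i < n" for i
    using arg_cong[OF e[OF that], of Re] by simp
  have Im: "(\<Sum>j<n. x i j * Im (v $ j)) = m * Im (v $ i)" if "i < n" for i
    using arg_cong[OF e[OF that], of Im] by simp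
  obtain i where i: "i < n" "v $ i \<noteq> 0" using v by (metis carrier_vecD eq_vecI index_zero_vec)
  then have "Re (v $ i) \<noteq> 0 \<or> Im (v $ i) \<noteq> 0" by (simp add: complex_eq_iff)
  then show ?thesis
    using that[of i "\<lambda>i. Re (v $ i)"] that[of i "\<lambda>i. Im (v $ i)"] i Re Im by auto
qed

text \<open>The form bound needed for \<open>two_diagonal_entries_le\<close> is the positive semidefiniteness of
  \<open>M I - X\<close>, the combination of the spectral projections of \<open>X\<close> with coefficients \<open>M - d l\<close>.\<close>

theorem spectral_bounds_sum_ge_diagonal:
  assumes n: "n \<ge> 2" and X: "X \<in> carrier_mat n n" and nonneg: "\<And>i j. i < n \<Longrightarrow> j < n \<Longrightarrow> 0 \<le> X $$ (i, j)"
    and u: "orthonormal_basis n u" and eig: "\<And>l. l < n \<Longrightarrow> X *\<^sub>v u l = complex_of_real (d l) \<cdot>\<^sub>v u l"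
    and M: "\<And>l. l < n \<Longrightarrow> d l \<le> M" and k: "k < n"
  shows "\<exists>i<n. \<exists>j<n. i \<noteq> j \<and> Re (X $$ (i, i)) + Re (X $$ (j, j)) \<le> M + d k"
proof -
  define x where "x = (\<lambda>i j. Re (X $$ (i, j)))"
  have Xx: "X $$ (i, j) = complex_of_real (x i j)" if "i < n" "j < n" for i j
    using nonneg[OF that] by (simp add: x_def less_eq_complex_def complex_eq_iff)
  note uc = orthonormal_basisD(1)[OF u]
  obtain z i0 where z: "i0 < n" "z i0 \<noteq> 0" "\<And>i. i < n \<Longrightarrow> (\<Sum>j<n. x i j * z j) = d k * z i"
    using real_eigenvector_of_real_matrix[OF X Xx uc[OF k] orthonormal_basisD(3)[OF u k] eig[OF k]] by blast
  have form: "(\<Sum>i<n. \<Sum>j<n. x i j * y i * y j) \<le> M * (\<Sum>i<n. (y i)\<^sup>2)" for y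
  proof -
    define v where "v = vec n (\<lambda>i. complex_of_real (y i))"
    have v: "v \<in> carrier_vec n" by (simp add: v_def)
    let ?R = "\<lambda>f. lincomb_mat n f (\<lambda>l. rank_one_mat (u l)) n"
    have form_R: "(?R f *\<^sub>v v) \<bullet>c v = (\<Sum>l<n. complex_of_real (f l) * ((rank_one_mat (u l) *\<^sub>v v) \<bullet>c v))" for f
      using uc v psd_rank_one_mat[OF uc] by (intro form_lincomb_mat) (auto simp: psd_mat_def hermitian_mat_def)
    have XR: "X = ?R d" by (rule spectral_decomposition[OF u X eig])
    have oneR: "1\<^sub>m n = ?R (\<lambda>_. 1)" using uc by (intro spectral_decomposition[OF u]) auto
    have "psd_mat n (?R (\<lambda>l. M - d l))" using M uc by (intro psd_lincomb_mat psd_rank_one_mat) auto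
    then have "0 \<le> Re ((?R (\<lambda>l. M - d l) *\<^sub>v v) \<bullet>c v)" using v by (simp add: psd_mat_iff)
    also have "(?R (\<lambda>l. M - d l) *\<^sub>v v) \<bullet>c v = M * ((1\<^sub>m n *\<^sub>v v) \<bullet>c v) - (X *\<^sub>v v) \<bullet>c v"
      unfolding XR oneR form_R by (simp add: sum_distrib_left left_diff_distrib sum_subtractf)
    finally have "Re ((X *\<^sub>v v) \<bullet>c v) \<le> M * Re (v \<bullet>c v)" using v by simp
    moreover have "(X *\<^sub>v v) \<bullet>c v = (\<Sum>i<n. \<Sum>j<n. complex_of_real (x i j * y i * y j))"
      unfolding cscalar_prod_sum[OF v]
    proof (intro sum.cong refl)
      fix i assume "i \<in> {..<n}"
      then have i: "i < n" by simp
      have "(X *\<^sub>v v) $ i = (\<Sum>j<n. complex_of_real (x i j * y j))"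
        unfolding mult_mat_vec_sum[OF X v i] using i by (intro sum.cong refl) (simp add: Xx v_def)
      then show "(X *\<^sub>v v) $ i * cnj (v $ i) = (\<Sum>j<n. complex_of_real (x i j * y i * y j))"
        using i by (simp add: v_def sum_distrib_left mult_ac)
    qed
    moreover have "v \<bullet>c v = complex_of_real (\<Sum>i<n. (y i)\<^sup>2)"
      unfolding cscalar_prod_self[OF v] by (simp add: v_def)
    ultimately show ?thesis by simp
  qed
  show ?thesis
    unfolding x_def[symmetric, THEN fun_cong, THEN fun_cong]
    using two_diagonal_entries_le[of n x z "d k" i0 M, OF n _ z(3,1,2) form] nonneg
    by (auto simp: x_def less_eq_complex_def)
qed

section \<open>The lower bound for the spectral radius\<close>

theorem corollary2p2:
  fixes n k :: nat
    and A X :: "complex mat"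
    and \<Phi> :: "complex mat \<Rightarrow> complex mat"
    and b11 b22 :: real
  assumes "n \<ge> 2" and "k \<ge> 1"
    and "A \<in> carrier_mat n n"
    and "\<forall>i<n. \<forall>j<n. 0 \<le> A $$ (i, j)"
    and "X = min_sym_mat A"
    and "linear_map_mat n k \<Phi>" and "positive_map n k \<Phi>" and "unital_map n k \<Phi>"
    and "b11 = sorted_diag A ! 0" and "b22 = sorted_diag A ! 1"
  shows "loewner_ge k
    (complex_of_real (spectral_radius A) \<cdot>\<^sub>m 1\<^sub>m k)
    (complex_of_real ((b11 + b22) / 2) \<cdot>\<^sub>m 1\<^sub>m k
      + psd_sqrt k (\<Phi> (X ^\<^sub>m 2) - (\<Phi> X) ^\<^sub>m 2))"
proof -
  note n = assms(1) and A = assms(3)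
  have A0: "A $$ (i, j) = complex_of_real (Re (A $$ (i, j)))" "0 \<le> Re (A $$ (i, j))" if "i < n" "j < n" for i j
    using assms(4) that by (auto simp: less_eq_complex_def complex_eq_iff)
  have X: "X \<in> carrier_mat n n" using A by (auto simp: assms(5) min_sym_mat_def)
  have Xij: "X $$ (i, j) = complex_of_real (min (Re (A $$ (i, j))) (Re (A $$ (j, i))))" if "i < n" "j < n" for i j
  proof -
    have "min (complex_of_real a) (complex_of_real b) = complex_of_real (min a b)" for a b
      by (simp add: min_def less_eq_complex_def)
    moreover have "X $$ (i, j) = min (A $$ (i, j)) (A $$ (j, i))"
      using A that by (simp add: assms(5) min_sym_mat_def)
    ultimately show ?thesis using A0(1)[OF that] A0(1)[OF that(2,1)] by metis
  qed
  have X0: "0 \<le> X $$ (i, j)" if "i < n" "j < n" for i j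
    using A0(2)[OF that] A0(2)[OF that(2,1)] that by (simp add: Xij less_eq_complex_def)
  have "hermitian_mat n X" unfolding hermitian_mat_iff using X by (auto simp: Xij min.commute)
  from hermitian_spectral[OF this] obtain u d where u: "orthonormal_basis n u"
    and eig: "\<And>l. l < n \<Longrightarrow> X *\<^sub>v u l = complex_of_real (d l) \<cdot>\<^sub>v u l" by blast
  note uc = orthonormal_basisD(1)[OF u] and u0 = orthonormal_basisD(3)[OF u]
  define \<rho> where "\<rho> = spectral_radius A"
  \<comment> \<open>\<open>\<rho>\<close> takes the place of the largest eigenvalue of \<open>X\<close> as the upper end of its spectrum\<close>
  have d_le: "d l \<le> \<rho>" if l: "l < n" for l
  proof -
    have "eigenvalue X (complex_of_real (d l))"
      using eig[OF l] uc[OF l] u0[OF l] X by (auto simp: eigenvalue_def eigenvector_def)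
    moreover have "complex_of_real (cmod (X $$ (i, j))) \<le> A $$ (i, j)" if "i < n" "j < n" for i j
      using assms(4) that by (simp add: Xij less_eq_complex_def)
    ultimately have "cmod (complex_of_real (d l)) \<le> \<rho>"
      unfolding \<rho>_def by (intro eigenvalue_le_spectral_radius_dominating[OF X A])
    then show ?thesis by simp
  qed
  define l0 where "l0 = arg_min_on d {..<n}"
  have l0: "l0 < n" and d_ge: "\<And>l. l < n \<Longrightarrow> d l0 \<le> d l"
    using arg_min_if_finite(1)[of "{..<n}" d] arg_min_least[of "{..<n}" _ d] n
    by (auto simp: l0_def lessThan_empty_iff)
  have diag: "b11 + b22 \<le> \<rho> + d l0"
  proof -
    obtain i j where ij: "i < n" "j < n" "i \<noteq> j"
      and le: "Re (X $$ (i, i)) + Re (X $$ (j, j)) \<le> \<rho> + d l0"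
      using spectral_bounds_sum_ge_diagonal[OF n X X0 u eig d_le l0] by blast
    define L where "L = map Re (diag_mat A)"
    have L: "length L = n" "\<And>i. i < n \<Longrightarrow> L ! i = Re (A $$ (i, i))" using A by (auto simp: L_def diag_mat_def)
    have "b11 + b22 \<le> L ! i + L ! j"
      unfolding assms(9,10) sorted_diag_def L_def[symmetric]
      using ij L(1) by (intro sort_two_smallest_le) auto
    also have "\<dots> \<le> \<rho> + d l0" using le ij by (simp add: L Xij)
    finally show ?thesis .
  qed
  let ?P = "\<lambda>l. rank_one_mat (u l)"
  define G where "G = (\<lambda>l. \<Phi> (?P l))"
  have Pc: "?P l \<in> carrier_mat n n" and Gpsd: "psd_mat k (G l)" if "l < n" for l
    using psd_rank_one_mat[OF uc[OF that]] assms(7) by (auto simp: psd_mat_def hermitian_mat_def G_def positive_map_def)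
  have \<Phi>R: "\<Phi> M = lincomb_mat k f G n"
    if "M \<in> carrier_mat n n" "\<And>l. l < n \<Longrightarrow> M *\<^sub>v u l = complex_of_real (f l) \<cdot>\<^sub>v u l" for M f
  proof -
    have "\<Phi> M = \<Phi> (lincomb_mat n f ?P n)"
      by (rule arg_cong[where f = \<Phi>], rule spectral_decomposition[OF u that])
    also have "\<dots> = lincomb_mat k f G n"
      unfolding G_def by (rule linear_map_lincomb_mat[OF assms(6) Pc])
    finally show ?thesis .
  qed
  have \<Phi>X: "\<Phi> X = lincomb_mat k d G n" by (rule \<Phi>R[OF X eig])
  have "1\<^sub>m k = lincomb_mat k (\<lambda>_. 1) G n"
    using \<Phi>R[of "1\<^sub>m n" "\<lambda>_. 1"] uc assms(8) by (auto simp: unital_map_def)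
  note one = this[symmetric]
  have "(X * X) *\<^sub>v u l = complex_of_real ((d l)\<^sup>2) \<cdot>\<^sub>v u l" if l: "l < n" for l
    by (simp add: assoc_mult_mat_vec[OF X X uc[OF l]] eig[OF l] mult_mat_vec[OF X uc[OF l]] smult_smult_assoc power2_eq_square)
  then have \<Phi>XX: "\<Phi> (X * X) = lincomb_mat k (\<lambda>l. (d l)\<^sup>2) G n" using X by (intro \<Phi>R) auto
  define S where "S = \<Phi> (X ^\<^sub>m 2) - (\<Phi> X) ^\<^sub>m 2"
  have pow2: "Y ^\<^sub>m 2 = Y * Y" if "Y \<in> carrier_mat p p" for Y :: "complex mat" and p
    using that by (simp add: numeral_2_eq_2)
  have S: "S = lincomb_mat k (\<lambda>l. (d l)\<^sup>2) G n - lincomb_mat k d G n * lincomb_mat k d G n"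
    unfolding S_def pow2[OF X] \<Phi>XX \<Phi>X pow2[OF lincomb_mat_carrier] ..
  have Spsd: "psd_mat k S" unfolding S by (rule psd_resolution_variance(1)[OF Gpsd one])
  define B where "B = psd_sqrt k S"
  have B: "psd_mat k B" "B * B = S" using psd_sqrt_props[OF Spsd] by (auto simp: B_def)
  have Bh: "hermitian_mat k B" and Bc: "B \<in> carrier_mat k k" using B by (auto simp: psd_mat_def hermitian_mat_def)
  define \<beta> where "\<beta> = (b11 + b22) / 2"
  \<comment> \<open>half the length of the interval containing the spectrum of \<open>X\<close>\<close>
  define c where "c = (\<rho> - d l0) / 2"
  have c0: "0 \<le> c" using d_le[OF l0] by (simp add: c_def)
  have c_le: "c \<le> \<rho> - \<beta>" using diag by (simp add: c_def \<beta>_def field_simps)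
  have Ble: "Re ((B *\<^sub>v v) \<bullet>c v) \<le> c * Re (v \<bullet>c v)" if v: "v \<in> carrier_vec k" for v
  proof (rule psd_le_of_square_le[OF B(1) c0 v])
    show "Re ((B * B *\<^sub>v v) \<bullet>c v) \<le> c\<^sup>2 * Re (v \<bullet>c v)"
      unfolding B(2) S c_def using psd_resolution_variance(2)[OF Gpsd one _ v] d_le d_ge by blast
  qed
  let ?I = "\<lambda>a. complex_of_real a \<cdot>\<^sub>m (1\<^sub>m k :: complex mat)"
  have Ih: "hermitian_mat k (?I a)" for a by (auto simp: hermitian_mat_iff)
  have Sum: "hermitian_mat k (?I \<beta> + B)"
    unfolding hermitian_mat_iff using Bc by (auto simp: hermitian_mat_cnj[OF Bh])
  have "psd_mat k (?I \<rho> - (?I \<beta> + B))"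
    unfolding psd_mat_iff
  proof (intro conjI ballI)
    show "hermitian_mat k (?I \<rho> - (?I \<beta> + B))" by (rule hermitian_mat_minus[OF Ih Sum])
    fix v :: "complex vec" assume v: "v \<in> carrier_vec k"
    have "?I \<rho> - (?I \<beta> + B) = ?I (\<rho> - \<beta>) - B" using Bc by (intro eq_matI) auto
    moreover have "(?I (\<rho> - \<beta>) - B) *\<^sub>v v = complex_of_real (\<rho> - \<beta>) \<cdot>\<^sub>v v - B *\<^sub>v v"
      using Bc v by (intro eq_vecI) (auto simp: minus_mult_distrib_mat_vec[of _ k k])
    ultimately have "((?I \<rho> - (?I \<beta> + B)) *\<^sub>v v) \<bullet>c v = complex_of_real (\<rho> - \<beta>) * (v \<bullet>c v) - (B *\<^sub>v v) \<bullet>c v"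
      using v Bc by (simp add: cscalar_prod_minus[of _ k] cscalar_prod_smult[of _ k])
    then have "Re (((?I \<rho> - (?I \<beta> + B)) *\<^sub>v v) \<bullet>c v) = (\<rho> - \<beta>) * Re (v \<bullet>c v) - Re ((B *\<^sub>v v) \<bullet>c v)"
      by simp
    moreover have "c * Re (v \<bullet>c v) \<le> (\<rho> - \<beta>) * Re (v \<bullet>c v)"
      using c_le cscalar_prod_self_Re(2)[OF v] by (rule mult_right_mono)
    ultimately show "0 \<le> Re (((?I \<rho> - (?I \<beta> + B)) *\<^sub>v v) \<bullet>c v)" using Ble[OF v] by simp
  qed
  then show ?thesis
    unfolding loewner_ge_def \<rho>_def[symmetric] \<beta>_def[symmetric] S_def[symmetric] B_def[symmetric]
    using Ih Sum by blast
qed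

end
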